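(* Let $\varphi_{r-1}$ denote the idempotent Ū-module endomorphism of $X^{\otimes (r-1)}$ with image $X_{r-1}$ and kernel $Y_{r-1}$, and for $\varepsilon\in\{+,-\}$ let $\rho^\varepsilon$ denote the idempotent Ū-module endomorphism of $X^{\otimes(2r-1)}$ with image $X_{r-1}^\varepsilon$ and kernel $X_{r-1}^{\bar\varepsilon}\oplus Y_{2r-1}$ (where $\bar\varepsilon$ is the sign opposite to $\varepsilon$). Fix Ū-module isomorphisms $\theta^\varepsilon : X_{r-1}^\varepsilon \to X_{r-1}$ and define Ū-module maps $$P^\varepsilon := \theta^\varepsilon\circ\rho^\varepsilon : X^{\otimes(2r-1)}\to X^{\otimes(r-1)},\qquad I^\varepsilon := (\theta^\varepsilon)^{-1}\circ\varphi_{r-1} : X^{\otimes(r-1)}\to X^{\otimes(2r-1)}$$ (with images regarded inside $X^{\otimes (r-1)}$, resp. $X^{\otimes(2r-1)}$). Then for all integers $m,m'\geq 0$, every Ū-module morphism $X^{\otimes m}\to X^{\otimes m'}$ is a $\mathbb{C}$-linear combination of morphisms obtained from $\mathrm{id}_X$, $c$, $e$, $P^+$, $P^-$, $I^+$, $I^-$ (and $\mathrm{id}_{\mathbb{C}}$) by finitely many compositions and tensor products. Equivalently, the image of the Temperley–Lieb category together with these four additional morphisms under the monoidal functor sending $1\mapsto X$, $\cup\mapsto c$, $\cap\mapsto e$ is full in the category of finite-dimensional Ū-modules on the objects $X^{\otimes m}$.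
   Context: Fix an odd integer $r\geq 3$ and $q=e^{2\pi i/r}$. Set $[k]=\frac{q^k-q^{-k}}{q-q^{-1}}$ and $[k]!=\prod_{j=1}^k[j]$. The small quantum group $\bar U$ is the $\mathbb{C}$-algebra generated by $E,F,K$ with relations $E^r=F^r=0$, $K^r=1$, $KEK^{-1}=q^2E$, $KFK^{-1}=q^{-2}F$, $[E,F]=\frac{K-K^{-1}}{q-q^{-1}}$, with coproduct $\Delta(E)=E\otimes K+1\otimes E$, $\Delta(F)=K^{-1}\otimes F+F\otimes 1$, $\Delta(K)=K\otimes K$, counit $\varepsilon(E)=\varepsilon(F)=0$, $\varepsilon(K)=1$; tensor products of modules use $\Delta$. $X$ is the 2-dimensional Ū-module with basis $a_0^1,a_1^1$ and $Ka_0^1=qa_0^1$, $Ka_1^1=q^{-1}a_1^1$, $Ea_0^1=0$, $Ea_1^1=a_0^1$, $Fa_0^1=a_1^1$, $Fa_1^1=0$. $X^{\otimes 0}=\mathbb{C}$. The Ū-module maps $c:\mathbb{C}\to X\otimes X$ and $e:X\otimes X\to\mathbb{C}$ are $c(1)=q\,a_0^1\otimes a_1^1-a_1^1\otimes a_0^1$ and $e(a_0^1\otimes a_0^1)=0$, $e(a_0^1\otimes a_1^1)=-1$, $e(a_1^1\otimes a_0^1)=q^{-1}$, $e(a_1^1\otimes a_1^1)=0$. For $0\le m\le r-1$, $X_m\subset X^{\otimes m}$ is the submodule with basis $a_j^m:=F^j\cdot(a_0^1\otimes\cdots\otimes a_0^1)$, $0\le j\le m$ (it is simple of dimension $m+1$),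 and $Y_m$ denotes the unique Ū-submodule with $X^{\otimes m}=X_m\oplus Y_m$. In $X^{\otimes(2r-1)}$, $X_{r-1}^+$ is the submodule generated by $a_0^1\otimes\cdots\otimes a_0^1$ and $X_{r-1}^-$ the submodule generated by $a_1^1\otimes\cdots\otimes a_1^1$; both are isomorphic to $X_{r-1}$, and $Y_{2r-1}$ denotes the unique Ū-submodule with $X^{\otimes(2r-1)}=X_{r-1}^+\oplus X_{r-1}^-\oplus Y_{2r-1}$. *)

theory Defs
  imports Complex_Main
begin

text \<open>Concrete model. The basis of X^{\<otimes> m} is indexed by words (bool lists of
length m); False stands for a_0^1 and True for a_1^1.  A vector of X^{\<otimes> m} is a
coefficient function supported on words of length m; a linear map
X^{\<otimes> m} \<rightarrow> X^{\<otimes> m'} is a matrix M, where M w' w is the coefficient of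
the basis word w' in the image of the basis word w.\<close>

type_synonym vec = "bool list \<Rightarrow> complex"
type_synonym mat = "bool list \<Rightarrow> bool list \<Rightarrow> complex"

definition qq :: "nat \<Rightarrow> complex" where
  "qq r = exp (2 * pi * \<i> / of_nat r)"

definition twords :: "nat \<Rightarrow> bool list set" where
  "twords m = {w. length w = m}"

definition wt :: "bool list \<Rightarrow> int" where
  "wt w = int (length (filter Not w)) - int (length (filter id w))"

text \<open>Action of E, F, K on X^{\<otimes> m} via the iterated coproduct:
 E acts as sum_i 1\<otimes>..\<otimes>1\<otimes>E\<otimes>K\<otimes>..\<otimes>K,
 F acts as sum_i K^{-1}\<otimes>..\<otimes>K^{-1}\<otimes>F\<otimes>1\<otimes>..\<otimes>1,
 K acts as K\<otimes>..\<otimes>K.\<close>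
definition Emat :: "nat \<Rightarrow> nat \<Rightarrow> mat" where
  "Emat r m w' w = (\<Sum>i<m. if length w = m \<and> w ! i \<and> w' = w[i := False]
                         then qq r powi wt (drop (Suc i) w) else 0)"

definition Fmat :: "nat \<Rightarrow> nat \<Rightarrow> mat" where
  "Fmat r m w' w = (\<Sum>i<m. if length w = m \<and> \<not> w ! i \<and> w' = w[i := True]
                         then qq r powi (- wt (take i w)) else 0)"

definition Kmat :: "nat \<Rightarrow> nat \<Rightarrow> mat" where
  "Kmat r m w' w = (if length w = m \<and> w' = w then qq r powi wt w else 0)"

definition actions :: "nat \<Rightarrow> nat \<Rightarrow> mat set" where
  "actions r m = {Emat r m, Fmat r m, Kmat r m}"

definition Vsp :: "nat \<Rightarrow> vec set" where
  "Vsp m = {v. \<forall>w. length w \<noteq> m \<longrightarrow> v w = 0}"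

definition app :: "nat \<Rightarrow> nat \<Rightarrow> mat \<Rightarrow> vec \<Rightarrow> vec" where
  "app m m' M v = (\<lambda>w'. if length w' = m' then (\<Sum>w\<in>twords m. M w' w * v w) else 0)"

definition bvec :: "bool list \<Rightarrow> vec" where
  "bvec w = (\<lambda>u. if u = w then 1 else 0)"

definition is_hom :: "nat \<Rightarrow> nat \<Rightarrow> nat \<Rightarrow> mat \<Rightarrow> bool" where
  "is_hom r m m' M \<longleftrightarrow>
     (\<forall>g \<in> {Emat, Fmat, Kmat}. \<forall>w'\<in>twords m'. \<forall>w\<in>twords m.
        (\<Sum>u\<in>twords m'. g r m' w' u * M u w) = (\<Sum>u\<in>twords m. M w' u * g r m u w))"

inductive_set lspan :: "vec set \<Rightarrow> vec set" for S where
  base: "v \<in> S \<Longrightarrow> v \<in> lspan S"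
| zero: "(\<lambda>_. 0) \<in> lspan S"
| add: "u \<in> lspan S \<Longrightarrow> v \<in> lspan S \<Longrightarrow> (\<lambda>w. u w + v w) \<in> lspan S"
| smult: "v \<in> lspan S \<Longrightarrow> (\<lambda>w. a * v w) \<in> lspan S"

inductive_set modgen :: "nat \<Rightarrow> nat \<Rightarrow> vec set \<Rightarrow> vec set" for r m S where
  base: "v \<in> S \<Longrightarrow> v \<in> modgen r m S"
| zero: "(\<lambda>_. 0) \<in> modgen r m S"
| add: "u \<in> modgen r m S \<Longrightarrow> v \<in> modgen r m S \<Longrightarrow> (\<lambda>w. u w + v w) \<in> modgen r m S"
| smult: "v \<in> modgen r m S \<Longrightarrow> (\<lambda>w. a * v w) \<in> modgen r m S"
| act: "v \<in> modgen r m S \<Longrightarrow> g \<in> actions r m \<Longrightarrow> app m m g v \<in> modgen r m S"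

definition is_submodule :: "nat \<Rightarrow> nat \<Rightarrow> vec set \<Rightarrow> bool" where
  "is_submodule r m W \<longleftrightarrow> W \<subseteq> Vsp m \<and> (\<lambda>_. 0) \<in> W \<and>
     (\<forall>u\<in>W. \<forall>v\<in>W. (\<lambda>w. u w + v w) \<in> W) \<and> (\<forall>a. \<forall>v\<in>W. (\<lambda>w. a * v w) \<in> W) \<and>
     (\<forall>g\<in>actions r m. \<forall>v\<in>W. app m m g v \<in> W)"

definition allzero :: "nat \<Rightarrow> vec" where "allzero m = bvec (replicate m False)"
definition allone :: "nat \<Rightarrow> vec" where "allone m = bvec (replicate m True)"

definition Xsimple :: "nat \<Rightarrow> nat \<Rightarrow> vec set" where
  "Xsimple r m = lspan {(app m m (Fmat r m) ^^ j) (allzero m) | j. j \<le> m}"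

definition Xplus :: "nat \<Rightarrow> vec set" where
  "Xplus r = modgen r (2*r-1) {allzero (2*r-1)}"
definition Xminus :: "nat \<Rightarrow> vec set" where
  "Xminus r = modgen r (2*r-1) {allone (2*r-1)}"

definition idX :: mat where "idX w' w = (if w' = w then 1 else 0)"
definition idC :: mat where "idC w' w = (if w' = w then 1 else 0)"
definition cmat :: "nat \<Rightarrow> mat" where
  "cmat r w' w = (if w = [] \<and> w' = [False, True] then qq r
                  else if w = [] \<and> w' = [True, False] then -1 else 0)"
definition emat :: "nat \<Rightarrow> mat" where
  "emat r w' w = (if w' = [] \<and> w = [False, True] then -1
                  else if w' = [] \<and> w = [True, False] then inverse (qq r) else 0)"

definition mcomp :: "nat \<Rightarrow> mat \<Rightarrow> mat \<Rightarrow> mat" where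
  "mcomp k B A = (\<lambda>w' w. \<Sum>u\<in>twords k. B w' u * A u w)"
definition mtensor :: "nat \<Rightarrow> nat \<Rightarrow> mat \<Rightarrow> mat \<Rightarrow> mat" where
  "mtensor m1 n1 A B = (\<lambda>w' w. A (take n1 w') (take m1 w) * B (drop n1 w') (drop m1 w))"

inductive_set TLgen :: "nat \<Rightarrow> mat \<Rightarrow> mat \<Rightarrow> mat \<Rightarrow> mat \<Rightarrow> (nat \<times> nat \<times> mat) set"
  for r Pp Pm Ip Im where
  g_idX: "(1, 1, idX) \<in> TLgen r Pp Pm Ip Im"
| g_idC: "(0, 0, idC) \<in> TLgen r Pp Pm Ip Im"
| g_c: "(0, 2, cmat r) \<in> TLgen r Pp Pm Ip Im"
| g_e: "(2, 0, emat r) \<in> TLgen r Pp Pm Ip Im"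
| g_Pp: "(2*r-1, r-1, Pp) \<in> TLgen r Pp Pm Ip Im"
| g_Pm: "(2*r-1, r-1, Pm) \<in> TLgen r Pp Pm Ip Im"
| g_Ip: "(r-1, 2*r-1, Ip) \<in> TLgen r Pp Pm Ip Im"
| g_Im: "(r-1, 2*r-1, Im) \<in> TLgen r Pp Pm Ip Im"
| g_comp: "(m, k, A) \<in> TLgen r Pp Pm Ip Im \<Longrightarrow> (k, n, B) \<in> TLgen r Pp Pm Ip Im
           \<Longrightarrow> (m, n, mcomp k B A) \<in> TLgen r Pp Pm Ip Im"
| g_tensor: "(m1, n1, A) \<in> TLgen r Pp Pm Ip Im \<Longrightarrow> (m2, n2, B) \<in> TLgen r Pp Pm Ip Im
           \<Longrightarrow> (m1 + m2, n1 + n2, mtensor m1 n1 A B) \<in> TLgen r Pp Pm Ip Im"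

definition mimage :: "nat \<Rightarrow> nat \<Rightarrow> mat \<Rightarrow> vec set" where
  "mimage m m' M = app m m' M ` Vsp m"
definition mkernel :: "nat \<Rightarrow> nat \<Rightarrow> mat \<Rightarrow> vec set" where
  "mkernel m m' M = {v \<in> Vsp m. app m m' M v = (\<lambda>_. 0)}"

definition idempotent_end :: "nat \<Rightarrow> mat \<Rightarrow> bool" where
  "idempotent_end m M \<longleftrightarrow> (\<forall>v\<in>Vsp m. app m m M (app m m M v) = app m m M v)"

definition is_mod_iso :: "nat \<Rightarrow> nat \<Rightarrow> nat \<Rightarrow> vec set \<Rightarrow> vec set \<Rightarrow> (vec \<Rightarrow> vec) \<Rightarrow> bool" where
  "is_mod_iso r m m' W W' \<theta> \<longleftrightarrow> bij_betw \<theta> W W' \<and>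
     (\<forall>u\<in>W. \<forall>v\<in>W. \<forall>a b. \<theta> (\<lambda>w. a * u w + b * v w) = (\<lambda>w. a * \<theta> u w + b * \<theta> v w)) \<and>
     (\<forall>g\<in>{Emat, Fmat, Kmat}. \<forall>v\<in>W. \<theta> (app m m (g r m) v) = app m' m' (g r m') (\<theta> v))"

definition Pmat :: "nat \<Rightarrow> (vec \<Rightarrow> vec) \<Rightarrow> mat \<Rightarrow> mat" where
  "Pmat r \<theta> \<rho> = (\<lambda>w' w. \<theta> (app (2*r-1) (2*r-1) \<rho> (bvec w)) w')"
definition Imat :: "nat \<Rightarrow> vec set \<Rightarrow> (vec \<Rightarrow> vec) \<Rightarrow> mat \<Rightarrow> mat" where
  "Imat r W \<theta> \<phi> = (\<lambda>w' w. inv_into W \<theta> (app (r-1) (r-1) \<phi> (bvec w)) w')"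

end

theory Submission
  imports Defs
begin

text \<open>
Let \<open>p_k\<close> be the Jones-Wenzl projection onto the simple module \<open>X_k\<close>,
which exists in the Temperley-Lieb category for \<open>k \<le> r - 1\<close>. By rotating strands with \<open>c\<close> and
\<open>e\<close>, whether all morphisms \<open>X^m \<rightarrow> X^n\<close> are generated depends only on \<open>m + n\<close>, so induct on
\<open>m + n\<close>. Since \<open>1 - p_k\<close> is a sum of maps factoring through \<open>X^{k-2}\<close>, it suffices to generate
\<open>(p_k \<otimes> 1) f p_m\<close>. Such a morphism is determined by the highest weight vector's image, in fact by
the coefficients of that image at the words \<open>0^k w\<close>: \<open>E\<close> propagates the vanishing of these
coefficients through the first tensor factor and \<open>F\<close> through the source.

If \<open>m + n \<le> 2 (r - 1)\<close>, take \<open>p_n f p_m\<close>, which is zero or a multiple of \<open>p_m\<close> (Schur). Otherwise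
\<open>f\<close> may be taken as a map \<open>X^{r-1} \<rightarrow> X^{r-1} \<otimes> X^l\<close>, and what is needed is a generated map with
leading coefficients supported at a single prescribed word \<open>w\<close> of weight divisible by \<open>r\<close>. The
words so attained are closed under exchanging adjacent letters (by \<open>c e + q^{\<plusminus>1}\<close>), under appending
\<open>0^r\<close> (by \<open>I^+\<close>) and under prepending \<open>1^r\<close> (by \<open>I^- p_{r-1}\<close>), and contain \<open>1^i 0^i\<close> for
\<open>i < r\<close> (nested cups); this produces every word of weight divisible by \<open>r\<close>.
\<close>

section \<open>Words and quantum integers\<close>

lemma twords_0 [simp]: "twords 0 = {[]}"
  by (auto simp: twords_def)

lemma twords_Suc: "twords (Suc n) = (\<lambda>w. False # w) ` twords n \<union> (\<lambda>w. True # w) ` twords n"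
proof (rule set_eqI)
  fix w :: "bool list"
  show "w \<in> twords (Suc n) \<longleftrightarrow> w \<in> (\<lambda>w. False # w) ` twords n \<union> (\<lambda>w. True # w) ` twords n"
    by (cases w) (auto simp: twords_def)
qed

lemma finite_twords [simp]: "finite (twords n)"
  by (induction n) (auto simp: twords_Suc)

lemma mem_twords [simp]: "w \<in> twords n \<longleftrightarrow> length w = n"
  by (simp add: twords_def)

lemma sum_twords_Suc:
  "(\<Sum>w\<in>twords (Suc n). f w) = (\<Sum>w\<in>twords n. f (False # w) + f (True # w))"
proof -
  have "(\<Sum>w\<in>twords (Suc n). f w)
      = (\<Sum>w\<in>(\<lambda>w. False # w) ` twords n. f w) + (\<Sum>w\<in>(\<lambda>w. True # w) ` twords n. f w)"
    unfolding twords_Suc by (rule sum.union_disjoint) auto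
  also have "\<dots> = (\<Sum>w\<in>twords n. f (False # w)) + (\<Sum>w\<in>twords n. f (True # w))"
    by (simp add: sum.reindex inj_on_def)
  finally show ?thesis by (simp add: sum.distrib)
qed

lemma sum_twords_append:
  "(\<Sum>w\<in>twords (a + b). f w) = (\<Sum>u\<in>twords a. \<Sum>v\<in>twords b. f (u @ v))"
  by (induction a arbitrary: f) (simp_all add: sum_twords_Suc sum.distrib)

lemma twords_split:
  assumes "length w = a + b"
  obtains u v where "w = u @ v" "length u = a" "length v = b"
  using assms by (intro that[of "take a w" "drop a w"]) auto

lemma sum_delta_mult [simp]:
  "finite A \<Longrightarrow> (\<Sum>u\<in>A. (if w = u then 1 else 0) * f u) = (if w \<in> A then f w else (0::complex))"
  "finite A \<Longrightarrow> (\<Sum>u\<in>A. (if u = w then 1 else 0) * f u) = (if w \<in> A then f w else (0::complex))"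
  "finite A \<Longrightarrow> (\<Sum>u\<in>A. f u * (if w = u then 1 else 0)) = (if w \<in> A then f w else (0::complex))"
  "finite A \<Longrightarrow> (\<Sum>u\<in>A. f u * (if u = w then 1 else 0)) = (if w \<in> A then f w else (0::complex))"
  by (simp_all add: if_distrib[where f="\<lambda>x. _ * x"] if_distrib[where f="\<lambda>x. x * _"] cong: if_cong)

text \<open>Matrices are total functions on pairs of words, but only entries at words of the right
  lengths carry meaning. This is equality of the linear maps they represent.\<close>

definition mat_eq :: "nat \<Rightarrow> nat \<Rightarrow> mat \<Rightarrow> mat \<Rightarrow> bool" where
  "mat_eq m n A B \<longleftrightarrow> (\<forall>w'\<in>twords n. \<forall>w\<in>twords m. A w' w = B w' w)"

lemma mat_eqI: "(\<And>w' w. length w' = n \<Longrightarrow> length w = m \<Longrightarrow> A w' w = B w' w) \<Longrightarrow> mat_eq m n A B"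
  by (simp add: mat_eq_def)

lemma mtensor_append [simp]:
  "length u' = n1 \<Longrightarrow> length u = m1 \<Longrightarrow>
   mtensor m1 n1 A B (u' @ v') (u @ v) = A u' u * B v' v"
  by (simp add: mtensor_def)

definition ones :: "bool list \<Rightarrow> nat" where "ones w = length (filter id w)"
definition zeros :: "bool list \<Rightarrow> nat" where "zeros w = length (filter Not w)"

lemma ones_simps [simp]:
  "ones [] = 0" "ones (x # w) = (if x then Suc (ones w) else ones w)" "ones (u @ w) = ones u + ones w"
  by (simp_all add: ones_def)

lemma zeros_simps [simp]:
  "zeros [] = 0" "zeros (x # w) = (if x then zeros w else Suc (zeros w))" "zeros (u @ w) = zeros u + zeros w"
  by (simp_all add: zeros_def)

lemma filter_replicate_simps [simp]:
  "ones (replicate n False) = 0" "ones (replicate n True) = n"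
  "zeros (replicate n False) = n" "zeros (replicate n True) = 0"
  by (induction n) auto

lemma zeros_plus_ones: "zeros w + ones w = length w"
  by (induction w) auto

lemma ones_le_length: "ones w \<le> length w"
  using zeros_plus_ones[of w] by simp

lemma wt_eq: "wt w = int (zeros w) - int (ones w)"
  by (simp add: wt_def ones_def zeros_def)

lemma wt_simps [simp]:
  "wt [] = 0" "wt (x # w) = (if x then -1 else 1) + wt w" "wt (u @ v) = wt u + wt v"
  by (auto simp: wt_eq)

lemma ones_eq_0_iff: "ones w = 0 \<longleftrightarrow> w = replicate (length w) False"
  by (induction w) auto

section \<open>Arithmetic at a primitive \<open>r\<close>-th root of unity of odd order\<close>

locale odd_root =
  fixes r :: nat
  assumes odd_r: "odd r" and r_ge_3: "r \<ge> 3"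
begin

abbreviation q :: complex where "q \<equiv> qq r"

lemma q_nonzero [simp]: "q \<noteq> 0"
  by (simp add: qq_def)

lemma q_power_eq_1_iff: "q ^ n = 1 \<longleftrightarrow> r dvd n"
proof -
  have r0: "r \<noteq> 0" using r_ge_3 by simp
  have "q ^ n = exp (of_real (2 * pi * (real n / real r)) * \<i>)"
    unfolding qq_def by (simp flip: exp_of_nat_mult add: field_simps)
  also have "\<dots> = cis (2 * pi * (real n / real r))"
    by (simp add: cis_conv_exp mult.commute)
  finally have eq: "q ^ n = cis (2 * pi * (real n / real r))" .
  have "cis (2 * pi * (real n / real r)) = 1 \<longleftrightarrow> (\<exists>i::int. real n / real r = of_int i)"
  proof
    assume "cis (2 * pi * (real n / real r)) = 1"
    then have "cos (2 * pi * (real n / real r)) = 1"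
      by (metis cis.sel(1) one_complex.sel(1))
    then obtain i :: int where "2 * pi * (real n / real r) = of_int i * 2 * pi"
      unfolding cos_one_2pi_int by blast
    then have "(2 * pi) * (real n / real r) = (2 * pi) * of_int i" by (simp only: mult_ac)
    then have "real n / real r = of_int i" using pi_gt_zero by (subst (asm) mult_cancel_left) simp
    then show "\<exists>i::int. real n / real r = of_int i" by blast
  next
    assume "\<exists>i::int. real n / real r = of_int i"
    then obtain i :: int where "real n / real r = of_int i" by blast
    then show "cis (2 * pi * (real n / real r)) = 1" by (simp add: cis_multiple_2pi)
  qed
  also have "\<dots> \<longleftrightarrow> r dvd n"
  proof
    assume "\<exists>i::int. real n / real r = of_int i"
    then obtain i :: int where "real n = of_int i * real r" using r0 by (auto simp: field_simps)
    then have "real_of_int (int n) = of_int (i * int r)" by simp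
    then have "int n = i * int r" using of_int_eq_iff by blast
    then show "r dvd n" by (metis dvd_triv_right int_dvd_int_iff)
  next
    assume "r dvd n"
    then obtain t where "n = r * t" by (elim dvdE)
    then show "\<exists>i::int. real n / real r = of_int i" using r0 by (intro exI[of _ "int t"]) simp
  qed
  finally show ?thesis using eq by simp
qed

lemma q_powi_eq_1_iff: "q powi n = 1 \<longleftrightarrow> int r dvd n"
  by (cases n rule: int_cases2) (simp_all add: power_int_minus q_power_eq_1_iff)

lemma q_powi_eq_iff: "q powi m = q powi n \<longleftrightarrow> int r dvd m - n"
  using q_powi_eq_1_iff[of "m - n"] by (simp add: power_int_diff)

definition qn :: "nat \<Rightarrow> complex" where
  "qn n = (q ^ n - inverse q ^ n) / (q - inverse q)"

lemma q_minus_inverse_nonzero: "q - inverse q \<noteq> 0"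
proof
  assume "q - inverse q = 0"
  then have "q ^ 2 = 1" by (simp add: field_simps power2_eq_square)
  then have "r dvd 2" by (simp add: q_power_eq_1_iff)
  then show False using r_ge_3 by (auto dest: dvd_imp_le)
qed

text \<open>[n] vanishes exactly when q^(2n) = 1, and oddness of \<open>r\<close> removes the factor
  2.\<close>

lemma qn_eq_0_iff: "qn n = 0 \<longleftrightarrow> r dvd n"
proof -
  have "qn n = 0 \<longleftrightarrow> q ^ n = inverse q ^ n"
    using q_minus_inverse_nonzero by (simp add: qn_def)
  also have "\<dots> \<longleftrightarrow> q ^ (2 * n) = 1"
    by (simp add: field_simps power_mult power2_eq_square power_mult_distrib)
  also have "\<dots> \<longleftrightarrow> r dvd n"
    using odd_r by (simp add: q_power_eq_1_iff coprime_dvd_mult_right_iff)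
  finally show ?thesis .
qed

lemma qn_nonzero: "0 < n \<Longrightarrow> n < r \<Longrightarrow> qn n \<noteq> 0"
  by (simp add: qn_eq_0_iff nat_dvd_not_less)

lemma qn_0 [simp]: "qn 0 = 0"
  by (simp add: qn_def)

lemma qn_add: "qn (m + n) = q ^ m * qn n + inverse q ^ n * qn m"
proof -
  have "q ^ m * (q ^ n - inverse q ^ n) + inverse q ^ n * (q ^ m - inverse q ^ m)
      = q ^ (m + n) - inverse q ^ (m + n)"
    by (simp only: power_add algebra_simps)
  then show ?thesis
    by (simp only: qn_def times_divide_eq_right flip: add_divide_distrib)
qed

lemma qn_1 [simp]: "qn (Suc 0) = 1"
  using q_minus_inverse_nonzero by (simp add: qn_def)

lemma qn_Suc: "qn (Suc n) = q ^ n + inverse q * qn n"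
  using qn_add[of n 1] by simp

lemma qn_Suc': "qn (Suc n) = inverse q ^ n + q * qn n"
  using qn_add[of 1 n] by simp

text \<open>\<open>\<alpha> w\<close> is q to the power minus the number of pairs of positions with
  a \<open>False\<close> before a \<open>True\<close>. These are the coefficients of F^j / [j]!
  applied to the highest weight word, see \<open>Fmat_power_allzero\<close>.\<close>

fun \<alpha> :: "bool list \<Rightarrow> complex" where
  "\<alpha> [] = 1"
| "\<alpha> (x # w) = (if x then 1 else inverse q ^ ones w) * \<alpha> w"

lemma \<alpha>_nonzero [simp]: "\<alpha> w \<noteq> 0"
  by (induction w) auto

lemma \<alpha>_replicate_False [simp]: "\<alpha> (replicate n False) = 1"
  by (induction n) auto

section \<open>Quantum factorials and Gaussian binomials\<close>

definition qfact :: "nat \<Rightarrow> complex" where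
  "qfact n = (\<Prod>i<n. qn (Suc i))"

lemma qfact_simps [simp]: "qfact 0 = 1" "qfact (Suc n) = qfact n * qn (Suc n)"
  by (simp_all add: qfact_def)

lemma qfact_nonzero: "n < r \<Longrightarrow> qfact n \<noteq> 0"
  by (induction n) (auto simp: qn_nonzero)

text \<open>The Gaussian binomial of z + j over j in the variable q^(-2), indexed by the numbers of
  zeros and ones of a word.\<close>

definition qbin :: "nat \<Rightarrow> nat \<Rightarrow> complex" where
  "qbin z j = inverse q ^ (z * j) * qfact (z + j) / (qfact z * qfact j)"

lemma qbin_nonzero: "z + j < r \<Longrightarrow> qbin z j \<noteq> 0"
  by (simp add: qbin_def qfact_nonzero)

lemma qbin_0 [simp]: "z < r \<Longrightarrow> qbin z 0 = 1" "j < r \<Longrightarrow> qbin 0 j = 1"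
  by (simp_all add: qbin_def qfact_nonzero)

lemma qbin_Suc_right:
  "z + j < r \<Longrightarrow> Suc j < r \<Longrightarrow> qn (Suc j) * qbin z (Suc j) = inverse q ^ z * qn (Suc (z + j)) * qbin z j"
  using qfact_nonzero[of z] qfact_nonzero[of j] qn_nonzero[of "Suc j"]
  by (simp add: qbin_def field_simps power_add)

lemma qbin_Suc_left:
  "z + j < r \<Longrightarrow> Suc z < r \<Longrightarrow> qn (Suc z) * qbin (Suc z) j = inverse q ^ j * qn (Suc (z + j)) * qbin z j"
  using qfact_nonzero[of z] qfact_nonzero[of j] qn_nonzero[of "Suc z"]
  by (simp add: qbin_def field_simps power_add)

text \<open>The addition formula splits [z + j + 2] into a multiple of [j + 1] and a multiple of
  [z + 1]; each cancels one factor of the denominator.\<close>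

lemma qbin_pascal:
  assumes "Suc (z + j) < r"
  shows "qbin (Suc z) (Suc j) = qbin (Suc z) j + inverse q ^ (2 * Suc j) * qbin z (Suc j)"
proof -
  have 0: "qfact z \<noteq> 0" "qfact j \<noteq> 0" "qn (Suc z) \<noteq> 0" "qn (Suc j) \<noteq> 0"
    using assms by (auto simp: qfact_nonzero qn_nonzero)
  have a: "qn (Suc (Suc (z + j))) = q ^ Suc z * qn (Suc j) + inverse q ^ Suc j * qn (Suc z)"
    using qn_add[of "Suc z" "Suc j"] by simp
  define A where "A = qfact (z + j) * qn (Suc (z + j)) / (qfact z * qfact j * qn (Suc z) * qn (Suc j))"
  have 1: "qbin (Suc z) (Suc j) = inverse q ^ (Suc z * Suc j) * qn (Suc (Suc (z + j))) * A"
    unfolding qbin_def A_def using 0 by (simp add: mult_ac)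
  have 2: "qbin (Suc z) j = inverse q ^ (Suc z * j) * qn (Suc j) * A"
    unfolding qbin_def A_def using 0 by (simp add: mult_ac)
  have 3: "qbin z (Suc j) = inverse q ^ (z * Suc j) * qn (Suc z) * A"
    unfolding qbin_def A_def using 0 by (simp add: mult_ac)
  have 4: "inverse q ^ (Suc z * Suc j) * q ^ Suc z = inverse q ^ (Suc z * j)"
    by (simp add: field_simps power_add)
  have 5: "inverse q ^ (Suc z * Suc j) * inverse q ^ Suc j = inverse q ^ (2 * Suc j) * inverse q ^ (z * Suc j)"
    by (simp flip: power_add add: algebra_simps mult_2_right)
  have "qbin (Suc z) (Suc j) = (inverse q ^ (Suc z * Suc j) * q ^ Suc z) * qn (Suc j) * A
      + (inverse q ^ (Suc z * Suc j) * inverse q ^ Suc j) * qn (Suc z) * A"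
    unfolding 1 a by (simp only: algebra_simps)
  then show ?thesis unfolding 2 3 4 5 by (simp only: mult.assoc)
qed

text \<open>Split by the first letter: a \<open>False\<close> in front of j ones contributes q^(-2j)
  to the square and a \<open>True\<close> contributes 1, so the sum obeys the Pascal rule. The value
  is the squared length by which \<open>jw\<close> is normalized.\<close>

lemma sum_\<alpha>_square:
  "z + j < r \<Longrightarrow> (\<Sum>w\<in>twords (z + j). if ones w = j then \<alpha> w ^ 2 else 0) = qbin z j"
proof (induction "z + j" arbitrary: z j)
  case 0
  then show ?case by simp
next
  case (Suc n)
  have IH: "(\<Sum>w\<in>twords n. if ones w = j' then \<alpha> w ^ 2 else 0) = qbin z' j'" if "n = z' + j'" for z' j'
    using Suc(1)[of z' j'] Suc(2,3) that by simp
  have "(\<Sum>w\<in>twords (Suc n). if ones w = j then \<alpha> w ^ 2 else 0)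
    = inverse q ^ (2 * j) * (\<Sum>w\<in>twords n. if ones w = j then \<alpha> w ^ 2 else 0)
      + (\<Sum>w\<in>twords n. if Suc (ones w) = j then \<alpha> w ^ 2 else 0)"
    unfolding sum_twords_Suc sum.distrib sum_distrib_left
    by (intro arg_cong2[where f="(+)"] sum.cong) (auto simp: power_mult_distrib mult.commute simp flip: power_mult)
  also have "\<dots> = qbin z j"
  proof (cases j)
    case 0
    then show ?thesis using Suc IH[of n 0] by simp
  next
    case (Suc j')
    have b: "(\<Sum>w\<in>twords n. if Suc (ones w) = j then \<alpha> w ^ 2 else 0) = qbin z j'"
      using IH[of z j'] \<open>Suc n = z + j\<close> Suc by simp
    show ?thesis
    proof (cases z)
      case 0
      have "(\<Sum>w\<in>twords n. if ones w = j then \<alpha> w ^ 2 else 0) = 0"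
      proof (intro sum.neutral ballI)
        fix w assume "w \<in> twords n"
        then show "(if ones w = j then \<alpha> w ^ 2 else 0) = 0"
          using zeros_plus_ones[of w] 0 \<open>Suc n = z + j\<close> by simp
      qed
      then show ?thesis using b 0 Suc \<open>Suc n = z + j\<close> \<open>z + j < r\<close> by simp
    next
      case (Suc z')
      then show ?thesis using b IH[of z' j] qbin_pascal[of z' j'] \<open>j = Suc j'\<close> \<open>Suc n = z + j\<close> \<open>z + j < r\<close>
        by simp
    qed
  qed
  finally show ?case using Suc by simp
qed

section \<open>The action of the small quantum group\<close>

text \<open>\<open>Eact\<close> and \<open>Fact\<close> act on coefficient functions, whatever the word length; \<open>Etr\<close> and \<open>Ftr\<close> are
their transposes, acting on the rows of a matrix.\<close>
fun Eact :: "vec \<Rightarrow> vec" where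
  "Eact v [] = 0"
| "Eact v (x # w) = Eact (\<lambda>u. v (x # u)) w + (if x then 0 else q powi wt w * v (True # w))"

fun Etr :: "vec \<Rightarrow> vec" where
  "Etr v [] = 0"
| "Etr v (x # w) = Etr (\<lambda>u. v (x # u)) w + (if x then q powi wt w * v (False # w) else 0)"

fun Fact :: "vec \<Rightarrow> vec" where
  "Fact v [] = 0"
| "Fact v (x # w) = (if x then q else inverse q) * Fact (\<lambda>u. v (x # u)) w
     + (if x then v (False # w) else 0)"

fun Ftr :: "vec \<Rightarrow> vec" where
  "Ftr v [] = 0"
| "Ftr v (x # w) = (if x then q else inverse q) * Ftr (\<lambda>u. v (x # u)) w
     + (if x then 0 else v (True # w))"

lemma act_cong:
  assumes "\<And>u. length u = length w \<Longrightarrow> v u = v' u"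
  shows "Eact v w = Eact v' w" "Etr v w = Etr v' w" "Fact v w = Fact v' w" "Ftr v w = Ftr v' w"
  using assms
proof (induction w arbitrary: v v')
  case (Cons x w)
  { case 1 then show ?case using Cons(1)[of "\<lambda>u. v (x # u)" "\<lambda>u. v' (x # u)"] by simp }
  { case 2 then show ?case using Cons(2)[of "\<lambda>u. v (x # u)" "\<lambda>u. v' (x # u)"] by simp }
  { case 3 then show ?case using Cons(3)[of "\<lambda>u. v (x # u)" "\<lambda>u. v' (x # u)"] by simp }
  { case 4 then show ?case using Cons(4)[of "\<lambda>u. v (x # u)" "\<lambda>u. v' (x # u)"] by simp }
qed auto

lemma Emat_Cons:
  assumes "length w = m" "length u = m"
  shows "Emat r (Suc m) (x # w) (y # u) = (if x = y then Emat r m w u else 0)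
     + (if y \<and> \<not> x \<and> w = u then q powi wt u else 0)"
  unfolding Emat_def sum.lessThan_Suc_shift using assms
  by (cases "x = y") (simp_all cong: if_cong add: conj_commute eq_commute[of w u])

lemma Fmat_Cons:
  assumes "length w = m" "length u = m"
  shows "Fmat r (Suc m) (x # w) (y # u)
     = (if x = y then (if x then q else inverse q) * Fmat r m w u else 0)
     + (if x \<and> \<not> y \<and> w = u then 1 else 0)"
proof -
  have "q powi (1 - wt z) = q * q powi (- wt z)" "q powi (- 1 - wt z) = inverse q * q powi (- wt z)" for z
    using power_int_add[of q 1 "- wt z"] power_int_add[of q "-1" "- wt z"] by (simp_all add: power_int_minus)
  then show ?thesis unfolding Fmat_def sum.lessThan_Suc_shift using assms
    by (cases "x = y") (auto cong: if_cong simp: sum_distrib_left if_distrib[where f="\<lambda>t. _ * t"])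
qed

lemma sum_Emat: "length w = m \<Longrightarrow> (\<Sum>u\<in>twords m. Emat r m w u * v u) = Eact v w"
proof (induction w arbitrary: v m)
  case Nil then show ?case by (simp add: Emat_def)
next
  case (Cons x w)
  then obtain n where n: "m = Suc n" "length w = n" by (cases m) auto
  have "(\<Sum>u\<in>twords m. Emat r m (x # w) u * v u)
     = (\<Sum>u\<in>twords n. Emat r n w u * v (x # u))
       + (\<Sum>u\<in>twords n. if u = w then (if x then 0 else q powi wt w * v (True # w)) else 0)"
    unfolding n(1) sum_twords_Suc sum.distrib[symmetric]
    by (intro sum.cong refl) (use n in \<open>cases x; auto simp: Emat_Cons algebra_simps\<close>)
  then show ?case using Cons n by simp
qed

lemma sum_Emat_left: "length w = m \<Longrightarrow> (\<Sum>u\<in>twords m. v u * Emat r m u w) = Etr v w"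
proof (induction w arbitrary: v m)
  case Nil then show ?case by (simp add: Emat_def)
next
  case (Cons x w)
  then obtain n where n: "m = Suc n" "length w = n" by (cases m) auto
  have "(\<Sum>u\<in>twords m. v u * Emat r m u (x # w))
     = (\<Sum>u\<in>twords n. v (x # u) * Emat r n u w)
       + (\<Sum>u\<in>twords n. if u = w then (if x then q powi wt w * v (False # w) else 0) else 0)"
    unfolding n(1) sum_twords_Suc sum.distrib[symmetric]
    by (intro sum.cong refl) (use n in \<open>cases x; auto simp: Emat_Cons algebra_simps\<close>)
  then show ?case using Cons n by simp
qed

lemma sum_Fmat: "length w = m \<Longrightarrow> (\<Sum>u\<in>twords m. Fmat r m w u * v u) = Fact v w"
proof (induction w arbitrary: v m)
  case Nil then show ?case by (simp add: Fmat_def)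
next
  case (Cons x w)
  then obtain n where n: "m = Suc n" "length w = n" by (cases m) auto
  have "(\<Sum>u\<in>twords m. Fmat r m (x # w) u * v u)
     = (if x then q else inverse q) * (\<Sum>u\<in>twords n. Fmat r n w u * v (x # u))
       + (\<Sum>u\<in>twords n. if u = w then (if x then v (False # w) else 0) else 0)"
    unfolding n(1) sum_twords_Suc sum_distrib_left sum.distrib[symmetric]
    by (intro sum.cong refl) (use n in \<open>cases x; auto simp: Fmat_Cons algebra_simps\<close>)
  then show ?case using Cons n by simp
qed

lemma sum_Fmat_left: "length w = m \<Longrightarrow> (\<Sum>u\<in>twords m. v u * Fmat r m u w) = Ftr v w"
proof (induction w arbitrary: v m)
  case Nil then show ?case by (simp add: Fmat_def)
next
  case (Cons x w)
  then obtain n where n: "m = Suc n" "length w = n" by (cases m) auto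
  have "(\<Sum>u\<in>twords m. v u * Fmat r m u (x # w))
     = (if x then q else inverse q) * (\<Sum>u\<in>twords n. v (x # u) * Fmat r n u w)
       + (\<Sum>u\<in>twords n. if u = w then (if x then 0 else v (True # w)) else 0)"
    unfolding n(1) sum_twords_Suc sum_distrib_left sum.distrib[symmetric]
    by (intro sum.cong refl) (use n in \<open>cases x; auto simp: Fmat_Cons algebra_simps\<close>)
  then show ?case using Cons n by simp
qed

lemma sum_Kmat: "length w = m \<Longrightarrow> (\<Sum>u\<in>twords m. Kmat r m w u * v u) = q powi wt w * v w"
proof -
  assume w: "length w = m"
  have "(\<Sum>u\<in>twords m. Kmat r m w u * v u) = (\<Sum>u\<in>twords m. (if w = u then 1 else 0) * (q powi wt u * v u))"
    by (intro sum.cong) (auto simp: Kmat_def)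
  then show ?thesis using w by simp
qed

lemma sum_Kmat_left: "length w = m \<Longrightarrow> (\<Sum>u\<in>twords m. v u * Kmat r m u w) = q powi wt w * v w"
proof -
  assume w: "length w = m"
  have "(\<Sum>u\<in>twords m. v u * Kmat r m u w) = (\<Sum>u\<in>twords m. (if w = u then 1 else 0) * (q powi wt u * v u))"
    using w by (intro sum.cong) (auto simp: Kmat_def)
  then show ?thesis using w by simp
qed

section \<open>Module maps in terms of the recursive actions\<close>

lemma is_hom_iff:
  "is_hom r m n M \<longleftrightarrow> (\<forall>w'\<in>twords n. \<forall>w\<in>twords m.
     Eact (\<lambda>u. M u w) w' = Etr (M w') w \<and>
     Fact (\<lambda>u. M u w) w' = Ftr (M w') w \<and>
     q powi wt w' * M w' w = q powi wt w * M w' w)"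
proof -
  have "(\<Sum>u\<in>twords n. Emat r n w' u * M u w) = (\<Sum>u\<in>twords m. M w' u * Emat r m u w)
      \<longleftrightarrow> Eact (\<lambda>u. M u w) w' = Etr (M w') w"
    "(\<Sum>u\<in>twords n. Fmat r n w' u * M u w) = (\<Sum>u\<in>twords m. M w' u * Fmat r m u w)
      \<longleftrightarrow> Fact (\<lambda>u. M u w) w' = Ftr (M w') w"
    "(\<Sum>u\<in>twords n. Kmat r n w' u * M u w) = (\<Sum>u\<in>twords m. M w' u * Kmat r m u w)
      \<longleftrightarrow> q powi wt w' * M w' w = q powi wt w * M w' w"
    if "w' \<in> twords n" "w \<in> twords m" for w w'
    using that by (simp_all only: mem_twords sum_Emat sum_Emat_left sum_Fmat sum_Fmat_left sum_Kmat sum_Kmat_left)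
  then show ?thesis unfolding is_hom_def by blast
qed

text \<open>The coproduct for a word cut in two: E on the left part is accompanied by K on the right
  one, and F on the right part by K^(-1) on the left one.\<close>

lemma act_append:
  "Eact v (u @ w) = q powi wt w * Eact (\<lambda>x. v (x @ w)) u + Eact (\<lambda>y. v (u @ y)) w"
  "Etr v (u @ w) = q powi wt w * Etr (\<lambda>x. v (x @ w)) u + Etr (\<lambda>y. v (u @ y)) w"
  "Fact v (u @ w) = Fact (\<lambda>x. v (x @ w)) u + q powi (- wt u) * Fact (\<lambda>y. v (u @ y)) w"
  "Ftr v (u @ w) = Ftr (\<lambda>x. v (x @ w)) u + q powi (- wt u) * Ftr (\<lambda>y. v (u @ y)) w"
proof (induction u arbitrary: v)
  case (Cons x u)
  have p: "q powi (1 - wt z) = q * q powi (- wt z)" "q powi (- wt z - 1) = inverse q * q powi (- wt z)" for z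
    using power_int_add[of q 1 "- wt z"] power_int_add[of q "- wt z" "-1"]
    by (simp_all add: power_int_minus mult.commute)
  { case 1 show ?case using Cons(1)[of "\<lambda>u. v (x # u)"] by (simp add: algebra_simps power_int_add) }
  { case 2 show ?case using Cons(2)[of "\<lambda>u. v (x # u)"] by (simp add: algebra_simps power_int_add) }
  { case 3 show ?case using Cons(3)[of "\<lambda>u. v (x # u)"] by (simp add: algebra_simps p) }
  { case 4 show ?case using Cons(4)[of "\<lambda>u. v (x # u)"] by (simp add: algebra_simps p) }
qed simp_all

lemma act_mult:
  "Eact (\<lambda>u. c * v u) w = c * Eact v w" "Etr (\<lambda>u. c * v u) w = c * Etr v w"
  "Fact (\<lambda>u. c * v u) w = c * Fact v w" "Ftr (\<lambda>u. c * v u) w = c * Ftr v w"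
  by (induction w arbitrary: v) (simp_all add: algebra_simps)

lemma act_mult_right:
  "Eact (\<lambda>u. v u * c) w = Eact v w * c" "Etr (\<lambda>u. v u * c) w = Etr v w * c"
  "Fact (\<lambda>u. v u * c) w = Fact v w * c" "Ftr (\<lambda>u. v u * c) w = Ftr v w * c"
  using act_mult[of c v w] by (simp_all add: mult.commute)

lemma act_add:
  "Eact (\<lambda>u. v u + v' u) w = Eact v w + Eact v' w" "Etr (\<lambda>u. v u + v' u) w = Etr v w + Etr v' w"
  "Fact (\<lambda>u. v u + v' u) w = Fact v w + Fact v' w" "Ftr (\<lambda>u. v u + v' u) w = Ftr v w + Ftr v' w"
  by (induction w arbitrary: v v') (simp_all add: algebra_simps)

lemma act_zero [simp]: "Eact (\<lambda>u. 0) w = 0" "Etr (\<lambda>u. 0) w = 0" "Fact (\<lambda>u. 0) w = 0" "Ftr (\<lambda>u. 0) w = 0"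
  by (induction w) simp_all

lemma is_homI:
  assumes "\<And>w' w. length w' = n \<Longrightarrow> length w = m \<Longrightarrow> Eact (\<lambda>u. M u w) w' = Etr (M w') w"
    and "\<And>w' w. length w' = n \<Longrightarrow> length w = m \<Longrightarrow> Fact (\<lambda>u. M u w) w' = Ftr (M w') w"
    and "\<And>w' w. length w' = n \<Longrightarrow> length w = m \<Longrightarrow> q powi wt w' * M w' w = q powi wt w * M w' w"
  shows "is_hom r m n M"
  unfolding is_hom_iff by (intro ballI conjI; rule assms) simp_all

lemma is_homD:
  assumes "is_hom r m n M" "length w' = n" "length w = m"
  shows "Eact (\<lambda>u. M u w) w' = Etr (M w') w" "Fact (\<lambda>u. M u w) w' = Ftr (M w') w"
    "q powi wt w' * M w' w = q powi wt w * M w' w"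
proof -
  have "w' \<in> twords n" "w \<in> twords m" using assms by simp_all
  then show "Eact (\<lambda>u. M u w) w' = Etr (M w') w" "Fact (\<lambda>u. M u w) w' = Ftr (M w') w"
    "q powi wt w' * M w' w = q powi wt w * M w' w"
    using assms(1) unfolding is_hom_iff by blast+
qed

lemma is_hom_cong:
  assumes AB: "mat_eq m n A B" and A: "is_hom r m n A"
  shows "is_hom r m n B"
  unfolding is_hom_def
proof (intro ballI)
  fix g :: "nat \<Rightarrow> nat \<Rightarrow> mat" and w' w
  assume g: "g \<in> {Emat, Fmat, Kmat}" and w: "w' \<in> twords n" "w \<in> twords m"
  have "(\<Sum>u\<in>twords n. g r n w' u * B u w) = (\<Sum>u\<in>twords n. g r n w' u * A u w)"
    using AB w by (intro sum.cong) (auto simp: mat_eq_def)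
  also have "\<dots> = (\<Sum>u\<in>twords m. A w' u * g r m u w)"
    using A g w unfolding is_hom_def by blast
  also have "\<dots> = (\<Sum>u\<in>twords m. B w' u * g r m u w)"
    using AB w by (intro sum.cong) (auto simp: mat_eq_def)
  finally show "(\<Sum>u\<in>twords n. g r n w' u * B u w) = (\<Sum>u\<in>twords m. B w' u * g r m u w)" .
qed

lemma is_hom_add:
  assumes A: "is_hom r m n A" and B: "is_hom r m n B"
  shows "is_hom r m n (\<lambda>w' w. A w' w + B w' w)"
proof (rule is_homI)
  fix w' w :: "bool list" assume l: "length w' = n" "length w = m"
  note D = is_homD[OF A l] is_homD[OF B l]
  show "Eact (\<lambda>u. A u w + B u w) w' = Etr (\<lambda>w. A w' w + B w' w) w"
    "Fact (\<lambda>u. A u w + B u w) w' = Ftr (\<lambda>w. A w' w + B w' w) w"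
    "q powi wt w' * (A w' w + B w' w) = q powi wt w * (A w' w + B w' w)"
    by (simp_all only: act_add distrib_left D)
qed

lemma is_hom_smult:
  assumes A: "is_hom r m n A"
  shows "is_hom r m n (\<lambda>w' w. c * A w' w)"
proof (rule is_homI)
  fix w' w :: "bool list" assume l: "length w' = n" "length w = m"
  show "Eact (\<lambda>u. c * A u w) w' = Etr (\<lambda>w. c * A w' w) w"
    "Fact (\<lambda>u. c * A u w) w' = Ftr (\<lambda>w. c * A w' w) w"
    "q powi wt w' * (c * A w' w) = q powi wt w * (c * A w' w)"
    by (simp_all only: act_mult mult.left_commute[of _ c] is_homD[OF A l])
qed

lemma is_hom_comp:
  assumes "is_hom r m k A" "is_hom r k n B"
  shows "is_hom r m n (mcomp k B A)"
  unfolding is_hom_def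
proof (intro ballI)
  fix g :: "nat \<Rightarrow> nat \<Rightarrow> mat" and w' w
  assume g: "g \<in> {Emat, Fmat, Kmat}" and w: "w' \<in> twords n" "w \<in> twords m"
  have B: "(\<Sum>u\<in>twords n. g r n w' u * B u x) = (\<Sum>u\<in>twords k. B w' u * g r k u x)"
    if "x \<in> twords k" for x
    using assms(2) g w that unfolding is_hom_def by blast
  have A: "(\<Sum>x\<in>twords k. g r k u x * A x w) = (\<Sum>x\<in>twords m. A u x * g r m x w)"
    if "u \<in> twords k" for u
    using assms(1) g w that unfolding is_hom_def by blast
  have "(\<Sum>u\<in>twords n. g r n w' u * mcomp k B A u w)
    = (\<Sum>x\<in>twords k. (\<Sum>u\<in>twords n. g r n w' u * B u x) * A x w)"
    unfolding mcomp_def sum_distrib_left sum_distrib_right mult.assoc by (rule sum.swap)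
  also have "\<dots> = (\<Sum>x\<in>twords k. (\<Sum>u\<in>twords k. B w' u * g r k u x) * A x w)"
    by (intro sum.cong refl) (simp only: B)
  also have "\<dots> = (\<Sum>u\<in>twords k. B w' u * (\<Sum>x\<in>twords k. g r k u x * A x w))"
    unfolding sum_distrib_left sum_distrib_right mult.assoc by (rule sum.swap)
  also have "\<dots> = (\<Sum>u\<in>twords k. B w' u * (\<Sum>x\<in>twords m. A u x * g r m x w))"
    by (intro sum.cong refl) (simp only: A)
  also have "\<dots> = (\<Sum>u\<in>twords m. mcomp k B A w' u * g r m u w)"
    unfolding mcomp_def sum_distrib_left sum_distrib_right mult.assoc by (rule sum.swap)
  finally show "(\<Sum>u\<in>twords n. g r n w' u * mcomp k B A u w) = (\<Sum>u\<in>twords m. mcomp k B A w' u * g r m u w)" .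
qed

lemma is_hom_tensor:
  assumes A: "is_hom r m1 n1 A" and B: "is_hom r m2 n2 B"
  shows "is_hom r (m1 + m2) (n1 + n2) (mtensor m1 n1 A B)"
  unfolding is_hom_iff
proof (intro ballI)
  fix w' w assume "w' \<in> twords (n1 + n2)" "w \<in> twords (m1 + m2)"
  then have l0: "length w' = n1 + n2" "length w = m1 + m2" by simp_all
  from l0(1) obtain u' v' where u': "w' = u' @ v'" "length u' = n1" "length v' = n2"
    by (rule twords_split)
  from l0(2) obtain u v where u: "w = u @ v" "length u = m1" "length v = m2"
    by (rule twords_split)
  note w = u'(1) u(1) and l = u'(2,3) u(2,3)
  let ?M = "mtensor m1 n1 A B"
  have a: "Eact (\<lambda>x. A x u) u' = Etr (A u') u" "Fact (\<lambda>x. A x u) u' = Ftr (A u') u"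
    "q powi wt u' * A u' u = q powi wt u * A u' u"
    by (simp_all only: is_homD[OF A l(1,3)])
  have b: "Eact (\<lambda>x. B x v) v' = Etr (B v') v" "Fact (\<lambda>x. B x v) v' = Ftr (B v') v"
    "q powi wt v' * B v' v = q powi wt v * B v' v"
    by (simp_all only: is_homD[OF B l(2,4)])
  \<comment> \<open>The coproduct leaves powers of q that depend on the target word on one side and
    on the source word on the other. They are matched by K-equivariance of \<open>B\<close> in the E
    identity and by K^(-1)-equivariance of \<open>A\<close> in the F identity.\<close>
  have a': "q powi (- wt u') * A u' u = q powi (- wt u) * A u' u"
    using a(3) by (auto simp: power_int_minus field_simps)
  have "Eact (\<lambda>x. ?M x w) w' = q powi wt v' * (Eact (\<lambda>x. A x u) u' * B v' v) + A u' u * Eact (\<lambda>x. B x v) v'"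
    unfolding w act_append
    by (subst act_cong(1)[of u' _ "\<lambda>x. A x u * B v' v"], use l in simp,
        subst act_cong(1)[of v' _ "\<lambda>x. A u' u * B x v"], use l in simp)
       (simp add: act_mult act_mult_right)
  moreover have "Etr (?M w') w = q powi wt v * (Etr (A u') u * B v' v) + A u' u * Etr (B v') v"
    unfolding w act_append
    by (subst act_cong(2)[of u _ "\<lambda>x. A u' x * B v' v"], use l in simp,
        subst act_cong(2)[of v _ "\<lambda>x. A u' u * B v' x"], use l in simp)
       (simp add: act_mult act_mult_right)
  moreover have "Fact (\<lambda>x. ?M x w) w' = Fact (\<lambda>x. A x u) u' * B v' v + q powi (- wt u') * (A u' u * Fact (\<lambda>x. B x v) v')"
    unfolding w act_append
    by (subst act_cong(3)[of u' _ "\<lambda>x. A x u * B v' v"], use l in simp,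
        subst act_cong(3)[of v' _ "\<lambda>x. A u' u * B x v"], use l in simp)
       (simp add: act_mult act_mult_right)
  moreover have "Ftr (?M w') w = Ftr (A u') u * B v' v + q powi (- wt u) * (A u' u * Ftr (B v') v)"
    unfolding w act_append
    by (subst act_cong(4)[of u _ "\<lambda>x. A u' x * B v' v"], use l in simp,
        subst act_cong(4)[of v _ "\<lambda>x. A u' u * B v' x"], use l in simp)
       (simp add: act_mult act_mult_right)
  moreover have "q powi wt w' * ?M w' w = (q powi wt u' * A u' u) * (q powi wt v' * B v' v)"
    "q powi wt w * ?M w' w = (q powi wt u * A u' u) * (q powi wt v * B v' v)"
    using w l by (simp_all add: power_int_add)
  moreover have "q powi wt v' * (x * B v' v) = q powi wt v * (x * B v' v)" for x
    by (metis b(3) mult.left_commute)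
  moreover have "q powi (- wt u') * (A u' u * x) = q powi (- wt u) * (A u' u * x)" for x
    by (metis a' mult.assoc)
  ultimately show "Eact (\<lambda>x. ?M x w) w' = Etr (?M w') w \<and> Fact (\<lambda>x. ?M x w) w' = Ftr (?M w') w
    \<and> q powi wt w' * ?M w' w = q powi wt w * ?M w' w"
    by (simp only: a b simp_thms)
qed

lemma is_hom_id: "is_hom r m m idX"
  unfolding is_hom_def idX_def by (intro ballI) simp

lemma length_2_conv: "length w = 2 \<longleftrightarrow> (\<exists>a b. w = [a, b])"
  by (auto simp: numeral_2_eq_2 length_Suc_conv)

lemma is_hom_cmat: "is_hom r 0 2 (cmat r)"
proof (rule is_homI)
  fix w' w :: "bool list" assume "length w' = 2" "length w = 0"
  then obtain a b where w: "w' = [a, b]" "w = []" by (auto simp: length_2_conv)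
  show "Eact (\<lambda>u. cmat r u w) w' = Etr (cmat r w') w" "Fact (\<lambda>u. cmat r u w) w' = Ftr (cmat r w') w"
    "q powi wt w' * cmat r w' w = q powi wt w * cmat r w' w"
    unfolding w by (cases a; cases b; simp add: cmat_def)+
qed

lemma is_hom_emat: "is_hom r 2 0 (emat r)"
proof (rule is_homI)
  fix w' w :: "bool list" assume "length w' = 0" "length w = 2"
  then obtain a b where w: "w = [a, b]" "w' = []" by (auto simp: length_2_conv)
  show "Eact (\<lambda>u. emat r u w) w' = Etr (emat r w') w" "Fact (\<lambda>u. emat r u w) w' = Ftr (emat r w') w"
    "q powi wt w' * emat r w' w = q powi wt w * emat r w' w"
    unfolding w by (cases a; cases b; simp add: emat_def)+
qed

lemma powi_wt: "q powi wt w = q ^ zeros w * inverse q ^ ones w"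
  by (simp add: wt_eq power_int_diff field_simps)

text \<open>The vectors \<open>b (ones u) * \<alpha> u\<close> are those annihilated by \<open>e\<close> at all adjacent positions; in
\<open>X^k\<close> with \<open>k < r\<close> they form \<open>X_k\<close>.\<close>
lemma Eact_sym: "Eact (\<lambda>u. b (ones u) * \<alpha> u) w = b (Suc (ones w)) * qn (zeros w) * \<alpha> w"
proof (induction w arbitrary: b)
  case (Cons x w)
  show ?case
  proof (cases x)
    case True
    then show ?thesis using Cons[of "\<lambda>j. b (Suc j)"] by simp
  next
    case False
    then show ?thesis using Cons[of "\<lambda>j. b j * inverse q ^ j"]
      by (simp add: mult.assoc powi_wt qn_Suc algebra_simps)
  qed
qed simp

lemma Fact_sym: "Fact (\<lambda>u. b (ones u) * \<alpha> u) w = b (ones w - 1) * qn (ones w) * \<alpha> w"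
proof (induction w arbitrary: b)
  case (Cons x w)
  show ?case
  proof (cases x)
    case True
    then show ?thesis using Cons[of "\<lambda>j. b (Suc j)"]
      by (cases "ones w") (simp_all add: qn_Suc' algebra_simps)
  next
    case False
    then show ?thesis using Cons[of "\<lambda>j. b j * inverse q ^ j"]
      by (cases "ones w") (simp_all add: mult.assoc algebra_simps)
  qed
qed simp

text \<open>Like E, the transpose of F reads \<open>b\<close> at one more \<open>True\<close>; the
  result is that of \<open>Eact_sym\<close> up to powers of q, which are invertible.\<close>

lemma Ftr_sym:
  "Ftr (\<lambda>u. b (ones u) * \<alpha> u) w
    = b (Suc (ones w)) * q ^ Suc (ones w) * inverse q ^ zeros w * qn (zeros w) * \<alpha> w"
proof (induction w arbitrary: b)
  case (Cons x w)
  show ?case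
  proof (cases x)
    case True
    then show ?thesis using Cons[of "\<lambda>j. b (Suc j)"] by simp
  next
    case False
    have 1: "inverse q ^ n * q ^ n = 1" "q ^ n * inverse q ^ n = 1" for n
      by (simp_all flip: power_mult_distrib)
    have "Ftr (\<lambda>u. b (ones (x # u)) * \<alpha> (x # u)) w
        = b (Suc (ones w)) * (inverse q ^ Suc (ones w) * q ^ Suc (ones w)) * inverse q ^ zeros w * qn (zeros w) * \<alpha> w"
      using False Cons[of "\<lambda>j. b j * inverse q ^ j"] by (simp add: mult_ac)
    then have "Ftr (\<lambda>u. b (ones u) * \<alpha> u) (x # w)
        = b (Suc (ones w)) * (inverse q * inverse q ^ zeros w * qn (zeros w) + 1) * \<alpha> w"
      using False by (simp add: 1 algebra_simps del: power_Suc)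
    also have "inverse q * inverse q ^ zeros w * qn (zeros w) + 1 = inverse q ^ zeros w * qn (Suc (zeros w))"
      by (simp add: qn_Suc distrib_left 1 mult_ac)
    also have "b (Suc (ones w)) * (inverse q ^ zeros w * qn (Suc (zeros w))) * \<alpha> w
       = b (Suc (ones w)) * (inverse q ^ ones w * q ^ ones w) * (inverse q * q) * (inverse q ^ zeros w * qn (Suc (zeros w))) * \<alpha> w"
      by (simp add: 1)
    finally show ?thesis using False by (simp add: mult_ac)
  qed
qed simp

lemma Etr_replicate_False [simp]: "Etr v (replicate m False) = 0"
  by (induction m arbitrary: v) auto

lemma act_eq_0:
  assumes "\<And>u. length u = length w \<Longrightarrow> v u = 0"
  shows "Eact v w = 0" "Etr v w = 0" "Fact v w = 0" "Ftr v w = 0"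
  using act_cong[of w v "\<lambda>_. 0"] assms by auto

text \<open>Equivariance under \<open>E\<close> kills the highest weight column, then equivariance under \<open>F\<close> the
remaining ones.\<close>
lemma hom_sym_eq_0:
  assumes h: "is_hom r m (k + n) h" and k: "k < r" and m: "m < r"
    and col: "\<And>u w x. length u = k \<Longrightarrow> length w = n \<Longrightarrow> length x = m
               \<Longrightarrow> h (u @ w) x = b (ones u) w x * \<alpha> u"
    and row: "\<And>w x. length w = k + n \<Longrightarrow> length x = m \<Longrightarrow> h w x = d w (ones x) * \<alpha> x"
    and 0: "\<And>w. length w = n \<Longrightarrow> h (replicate k False @ w) (replicate m False) = 0"
    and len: "length w = k + n" "length x = m"
  shows "h w x = 0"
proof -
  let ?x0 = "replicate m False"
  have "length w = n \<Longrightarrow> j \<le> k \<Longrightarrow> b j w ?x0 = 0" for j w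
  proof (induction j arbitrary: w)
    case 0
    then show ?case using assms(6)[of w] col[of "replicate k False" w ?x0] by simp
  next
    case (Suc j)
    \<comment> \<open>A word with j ones and k - j zeros: E evaluated there returns the next
      coefficient, with the factor [k - j], nonzero because 0 < k - j < r.\<close>
    define u where "u = replicate (k - j) False @ replicate j True"
    have u: "length u = k" "ones u = j" "zeros u = k - j" using Suc by (simp_all add: u_def)
    \<comment> \<open>The right-hand side of E-equivariance is 0 since E kills the highest weight
      vector of the source.\<close>
    have "0 = Eact (\<lambda>y. h y ?x0) (u @ w)"
      using is_homD(1)[OF h, of "u @ w" ?x0] u Suc by simp
    \<comment> \<open>The summand with E on the second factor sees only words beginning with
      \<open>u\<close>. Their coefficients vanish by the induction hypothesis, which is available
      for every second part.\<close>
    also have "\<dots> = q powi wt w * Eact (\<lambda>y. h (y @ w) ?x0) u"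
      using Suc u by (simp add: act_append act_eq_0 col)
    also have "Eact (\<lambda>y. h (y @ w) ?x0) u = Eact (\<lambda>y. b (ones y) w ?x0 * \<alpha> y) u"
      using Suc u by (intro act_cong) (simp add: col)
    also have "\<dots> = b (Suc j) w ?x0 * qn (k - j) * \<alpha> u"
      using u by (simp add: Eact_sym[where b="\<lambda>j. b j w ?x0"])
    finally show ?case using qn_nonzero[of "k - j"] Suc k by simp
  qed
  then have col0: "h w ?x0 = 0" if "length w = k + n" for w
  proof -
    from that obtain u v where u: "w = u @ v" "length u = k" "length v = n" by (rule twords_split)
    then have "ones u \<le> k" using ones_le_length by metis
    then show ?thesis using u col[of u v ?x0] \<open>\<And>w j. length w = n \<Longrightarrow> j \<le> k \<Longrightarrow> b j w ?x0 = 0\<close> by simp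
  qed
  have "j \<le> m \<Longrightarrow> length w = k + n \<Longrightarrow> d w j = 0" for j w
  proof (induction j arbitrary: w)
    case 0
    then show ?case using col0[of w] row[of w ?x0] by simp
  next
    case (Suc j)
    define u where "u = replicate (m - j) False @ replicate j True"
    have u: "length u = m" "ones u = j" "zeros u = m - j" using Suc by (simp_all add: u_def)
    \<comment> \<open>Column \<open>u\<close> has j ones and vanishes entirely by the induction
      hypothesis; equivariance then makes the row side vanish, where F reads the coefficient for j +
      1 ones.\<close>
    have "0 = Fact (\<lambda>y. h y u) w"
      using Suc u by (simp add: row act_eq_0)
    also have "\<dots> = Ftr (h w) u" using is_homD(2)[OF h, of w u] u Suc by simp
    also have "\<dots> = Ftr (\<lambda>y. d w (ones y) * \<alpha> y) u"
      using Suc u by (intro act_cong) (simp add: row)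
    also have "\<dots> = d w (Suc j) * q ^ Suc j * inverse q ^ (m - j) * qn (m - j) * \<alpha> u"
      using u by (simp add: Ftr_sym)
    finally show ?case using qn_nonzero[of "m - j"] Suc m by simp
  qed
  moreover have "ones x \<le> m" using len ones_le_length by metis
  ultimately show ?thesis using row[of w x] len by simp
qed

section \<open>Jones-Wenzl projections\<close>

text \<open>The projection onto X_k for k < r in closed form: on each weight space it is the outer
  product of the vector \<open>\<alpha>\<close> with itself, divided by its squared length. The
  formula does not mention k, so one matrix serves all lengths.\<close>

definition jw :: mat where
  "jw w' w = (if ones w' = ones w then \<alpha> w' * \<alpha> w / qbin (zeros w) (ones w) else 0)"

lemma jw_replicate_False:
  assumes "k < r" "length u = k"
  shows "jw (replicate k False) u = (if u = replicate k False then 1 else 0)"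
    "jw u (replicate k False) = (if u = replicate k False then 1 else 0)"
  using assms ones_eq_0_iff[of u] by (auto simp: jw_def)

lemma jw_short: "length w' = k \<Longrightarrow> length w = k \<Longrightarrow> k \<le> 1 \<Longrightarrow> jw w' w = (if w' = w then 1 else 0)"
  using r_ge_3 by (cases w; cases w') (auto simp: jw_def split: if_splits)

text \<open>This is the middle of P e_1 P in Wenzl's recursion; \<open>a\<close> and
  \<open>b\<close> are the letters on the strand that e_1 joins to the new first strand. Only words
  \<open>s\<close> of one weight contribute, and their squares sum to a Gaussian binomial by
  \<open>sum_\<alpha>_square\<close>.\<close>

lemma sum_jw_jw:
  assumes l: "Suc l < r" and u: "length u' = Suc l" "length u = Suc l"
  shows "(\<Sum>s\<in>twords l. jw u' (a # s) * jw (b # s) u)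
    = (if \<exists>j\<le>l. ones u' = of_bool a + j \<and> ones u = of_bool b + j
       then \<alpha> u' * \<alpha> u * inverse q ^ ((ones u - of_bool b) * (of_bool (\<not> a) + of_bool (\<not> b)))
         * qbin (l - (ones u - of_bool b)) (ones u - of_bool b)
         / (qbin (zeros u') (ones u') * qbin (zeros u) (ones u))
       else 0)"
proof (cases "\<exists>j\<le>l. ones u' = of_bool a + j \<and> ones u = of_bool b + j")
  case False
  have "jw u' (a # s) * jw (b # s) u = 0" if "length s = l" for s
  proof (rule ccontr)
    assume "jw u' (a # s) * jw (b # s) u \<noteq> 0"
    then have "ones u' = of_bool a + ones s \<and> ones u = of_bool b + ones s"
      by (auto simp: jw_def split: if_splits)
    then show False using False ones_le_length[of s] that by blast
  qed
  then have "(\<Sum>s\<in>twords l. jw u' (a # s) * jw (b # s) u) = 0" by (intro sum.neutral) simp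
  then show ?thesis by (simp only: False if_False)
next
  case True
  then obtain j where j: "j \<le> l" "ones u' = of_bool a + j" "ones u = of_bool b + j" by blast
  have "jw u' (a # s) * jw (b # s) u = \<alpha> u' * \<alpha> u * inverse q ^ (j * (of_bool (\<not> a) + of_bool (\<not> b)))
      / (qbin (zeros u') (ones u') * qbin (zeros u) (ones u)) * (if ones s = j then \<alpha> s ^ 2 else 0)"
    if "length s = l" for s
  proof -
    have "zeros (a # s) = zeros u'" if "ones s = j"
      using that \<open>length s = l\<close> zeros_plus_ones[of "a # s"] zeros_plus_ones[of u'] j u by auto
    then show ?thesis using j
      by (cases a; cases b) (auto simp: jw_def power2_eq_square power_add mult_2_right)
  qed
  then have "(\<Sum>s\<in>twords l. jw u' (a # s) * jw (b # s) u)
    = \<alpha> u' * \<alpha> u * inverse q ^ (j * (of_bool (\<not> a) + of_bool (\<not> b)))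
      / (qbin (zeros u') (ones u') * qbin (zeros u) (ones u)) * (\<Sum>s\<in>twords l. if ones s = j then \<alpha> s ^ 2 else 0)"
    by (simp add: sum_distrib_left)
  also have "(\<Sum>s\<in>twords l. if ones s = j then \<alpha> s ^ 2 else 0) = qbin (l - j) j"
    using sum_\<alpha>_square[of "l - j" j] j l by simp
  finally show ?thesis using True j by simp
qed

text \<open>The three types of entries in \<open>jw_Cons\<close> without their common
  \<open>\<alpha>\<close> factors: first letters both \<open>True\<close>, both
  \<open>False\<close>, or different. The first two rest on the addition formula for [z + j + 2],
  the third is cancellation. Here \<open>c\<close> is Wenzl's coefficient.\<close>

lemma inverse_qbin_recurrences:
  assumes "Suc (Suc (z + j)) < r"
  defines "c \<equiv> qn (Suc (z + j)) / qn (Suc (Suc (z + j)))"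
  shows "1 / qbin (Suc z) (Suc j)
      = 1 / qbin (Suc z) j - c * inverse q * (inverse q ^ (j + j) * qbin z j / (qbin (Suc z) j * qbin (Suc z) j))"
    "inverse q ^ Suc j * inverse q ^ Suc j / qbin (Suc z) (Suc j)
      = 1 / qbin z (Suc j) - c * q * (qbin z j / (qbin z (Suc j) * qbin z (Suc j)))"
    "inverse q ^ Suc j / qbin (Suc z) (Suc j)
      = c * (inverse q ^ j * qbin z j / (qbin z (Suc j) * qbin (Suc z) j))"
proof -
  define A J L M B where "A = qn (Suc z)" "J = qn (Suc j)" "L = qn (Suc (z + j))"
    "M = qn (Suc (Suc (z + j)))" "B = qbin z j"
  note defs = this
  define x y where "x = q ^ z" "y = q ^ j"
  note xy = this
  have nz: "A \<noteq> 0" "J \<noteq> 0" "L \<noteq> 0" "M \<noteq> 0" "B \<noteq> 0" "x \<noteq> 0" "y \<noteq> 0"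
    using assms by (auto simp: defs xy qn_nonzero qbin_nonzero)
  have X: "qbin (Suc z) j = L * B / (y * A)"
    using qbin_Suc_left[of z j] nz assms by (simp add: defs xy field_simps)
  have Y: "qbin z (Suc j) = L * B / (x * J)"
    using qbin_Suc_right[of z j] nz assms by (simp add: defs xy field_simps)
  have W: "qbin (Suc z) (Suc j) = M * (L * B / (y * A)) / (q * x * J)"
    using qbin_Suc_right[of "Suc z" j] nz assms unfolding X by (simp add: defs xy field_simps)
  have M: "M = q * x * J + A / (q * y)" "M = q * y * A + J / (q * x)"
    using qn_add[of "Suc z" "Suc j"] qn_add[of "Suc j" "Suc z"]
    by (simp_all add: defs xy field_simps add.commute)
  have p: "inverse q ^ j = inverse y" "inverse q ^ (j + j) = inverse y * inverse y"
    "inverse q ^ Suc j = inverse q * inverse y"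
    by (simp_all add: xy power_add power_inverse)
  have c: "c = L / M" by (simp add: c_def defs)
  show "1 / qbin (Suc z) (Suc j)
      = 1 / qbin (Suc z) j - c * inverse q * (inverse q ^ (j + j) * qbin z j / (qbin (Suc z) j * qbin (Suc z) j))"
  proof -
    have "1 / qbin (Suc z) (Suc j) = (y * A) / (L * B) * ((q * x * J) / M)"
      unfolding W by simp
    also have "(q * x * J) / M = 1 - A / (q * y) / M"
    proof -
      have "q * x * J = M - A / (q * y)" using M(1) by simp
      then show ?thesis using nz by (simp only: diff_divide_distrib divide_self[OF nz(4)])
    qed
    also have "(y * A) / (L * B) * \<dots> = 1 / qbin (Suc z) j - c * inverse q * (inverse q ^ (j + j) * qbin z j / (qbin (Suc z) j * qbin (Suc z) j))"
      unfolding X c p defs(5)[symmetric] using nz by (simp add: field_simps)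
    finally show ?thesis .
  qed
  show "inverse q ^ Suc j * inverse q ^ Suc j / qbin (Suc z) (Suc j)
      = 1 / qbin z (Suc j) - c * q * (qbin z j / (qbin z (Suc j) * qbin z (Suc j)))"
  proof -
    have "inverse q ^ Suc j * inverse q ^ Suc j / qbin (Suc z) (Suc j) = (x * J) / (L * B) * ((A / (q * y)) / M)"
      unfolding W p using nz by (simp add: field_simps)
    also have "(A / (q * y)) / M = 1 - q * x * J / M"
    proof -
      have "A / (q * y) = M - q * x * J" using M(1) by simp
      then show ?thesis using nz by (simp only: diff_divide_distrib divide_self[OF nz(4)])
    qed
    also have "(x * J) / (L * B) * \<dots> = 1 / qbin z (Suc j) - c * q * (qbin z j / (qbin z (Suc j) * qbin z (Suc j)))"
      unfolding Y c p defs(5)[symmetric] using nz by (simp add: field_simps)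
    finally show ?thesis .
  qed
  show "inverse q ^ Suc j / qbin (Suc z) (Suc j)
      = c * (inverse q ^ j * qbin z j / (qbin z (Suc j) * qbin (Suc z) j))"
    unfolding X Y W c p defs(5)[symmetric] using nz by (simp add: field_simps)
qed

text \<open>Wenzl's recursion \<open>p_{k+1} = P + ([k]/[k+1]) P e_1 P\<close> with \<open>P = 1 \<otimes> p_k\<close>, written out in
matrix entries; the loop value is \<open>-[2]\<close>, whence the sign.\<close>
lemma jw_Cons:
  assumes l: "Suc (Suc l) < r" and u: "length u' = Suc l" "length u = Suc l"
  shows "jw (x' # u') (x # u) = (if x' = x then jw u' u else 0)
    + qn (Suc l) / qn (Suc (Suc l)) * (cmat r [x', \<not> x'] [] * emat r [] [x, \<not> x]
        * (\<Sum>s\<in>twords l. jw u' ((\<not> x') # s) * jw ((\<not> x) # s) u))"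
proof -
  have zo: "zeros u + ones u = Suc l" "zeros u' + ones u' = Suc l"
    using zeros_plus_ones u by metis+
  note S = sum_jw_jw[OF Suc_lessD[OF l] u]
  consider "x'" "x" | "\<not> x'" "\<not> x" | "\<not> x'" "x" | "x'" "\<not> x" by blast
  then show ?thesis
  proof cases
    case 1
    show ?thesis
    proof (cases "ones u' = ones u")
      case True
      show ?thesis
      proof (cases "zeros u")
        \<comment> \<open>Here \<open>u\<close> consists of ones only, so no \<open>s\<close> has
          the required weight and the correction term vanishes.\<close>
        case 0
        then show ?thesis using 1 True zo l unfolding S by (auto simp: jw_def)
      next
        case (Suc z)
        have z: "l - ones u = z" "ones u \<le> l" "z + ones u = l" "zeros u' = Suc z" using zo Suc True by simp_all
        show ?thesis using arg_cong[OF inverse_qbin_recurrences(1)[of z "ones u"], of "(*) (\<alpha> u * \<alpha> u')"] l 1 True z Suc unfolding S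
          by (simp add: jw_def cmat_def emat_def) (simp add: algebra_simps divide_inverse)
      qed
    next
      case False
      then show ?thesis using 1 unfolding S by (auto simp: jw_def)
    qed
  next
    case 2
    show ?thesis
    proof (cases "ones u' = ones u")
      case True
      show ?thesis
      proof (cases "ones u")
        case 0
        then show ?thesis using 2 True zo l unfolding S by (auto simp: jw_def)
      next
        case (Suc j)
        have z: "l - j = zeros u" "j \<le> l" "zeros u + j = l" "zeros u' = zeros u" using zo Suc True by simp_all
        show ?thesis using arg_cong[OF inverse_qbin_recurrences(2)[of "zeros u" j], of "(*) (\<alpha> u * \<alpha> u')"] l 2 True z Suc unfolding S
          by (simp add: jw_def cmat_def emat_def) (simp add: algebra_simps divide_inverse)
      qed
    next
      case False
      then show ?thesis using 2 unfolding S by (auto simp: jw_def)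
    qed
  next
    case 3
    show ?thesis
    proof (cases "ones u' = Suc (ones u)")
      case True
      then obtain z where "zeros u = Suc z" using zo by (cases "zeros u") auto
      then have z: "l - ones u = z" "ones u \<le> l" "z + ones u = l" "zeros u' = z" "zeros u = Suc z"
        using zo True by simp_all
      show ?thesis using inverse_qbin_recurrences(3)[of z "ones u"] l 3 True z unfolding S
        by (simp add: jw_def cmat_def emat_def) (simp add: algebra_simps divide_inverse)
    next
      case False
      then show ?thesis using 3 unfolding S by (auto simp: jw_def)
    qed
  next
    case 4
    show ?thesis
    proof (cases "ones u = Suc (ones u')")
      case True
      then obtain z where "zeros u' = Suc z" using zo by (cases "zeros u'") auto
      then have z: "l - ones u' = z" "ones u' \<le> l" "z + ones u' = l" "zeros u = z" "zeros u' = Suc z"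
        using zo True by simp_all
      show ?thesis using inverse_qbin_recurrences(3)[of z "ones u'"] l 4 True z unfolding S
        by (simp add: jw_def cmat_def emat_def) (simp add: algebra_simps divide_inverse)
    next
      case False
      then show ?thesis using 4 unfolding S by (auto simp: jw_def)
    qed
  qed
qed

end

lemma mtensor_1_Cons [simp]:
  "mtensor (Suc 0) (Suc 0) A B (x' # u') (x # u) = A [x'] [x] * B u' u"
  by (simp add: mtensor_def)

lemma mtensor_0_2_Cons [simp]: "mtensor 0 2 A B (a # b # t) s = A [a, b] [] * B t s"
  by (simp add: mtensor_def)

lemma mtensor_2_0_Cons [simp]: "mtensor 2 0 A B s (a # b # t) = A [] [a, b] * B s t"
  by (simp add: mtensor_def)

lemma sum_idX [simp]:
  "(\<Sum>u\<in>twords n. idX w u * f u) = (if length w = n then f w else 0)"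
  "(\<Sum>u\<in>twords n. idX u w * f u) = (if length w = n then f w else 0)"
  "(\<Sum>u\<in>twords n. f u * idX w u) = (if length w = n then f w else 0)"
  "(\<Sum>u\<in>twords n. f u * idX u w) = (if length w = n then f w else 0)"
  by (simp_all add: idX_def)

lemma mcomp_assoc: "mcomp k C (mcomp j B A) = mcomp j (mcomp k C B) A"
  unfolding mcomp_def sum_distrib_left sum_distrib_right mult.assoc
  by (intro ext) (rule sum.swap)

lemma sum_list_concat_map:
  "(\<Sum>z\<leftarrow>concat (map h xs). g z) = (\<Sum>x\<leftarrow>xs. \<Sum>z\<leftarrow>h x. g z)" for g :: "_ \<Rightarrow> complex"
  by (induction xs) simp_all

lemma sum_sum_list: "(\<Sum>u\<in>S. \<Sum>x\<leftarrow>xs. f u x) = (\<Sum>x\<leftarrow>xs. \<Sum>u\<in>S. f u x)" for f :: "_ \<Rightarrow> _ \<Rightarrow> complex"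
  by (induction xs) (simp_all add: sum.distrib)

lemma sum_list_mult_sum_list:
  "(\<Sum>x\<leftarrow>xs. f x) * (\<Sum>y\<leftarrow>ys. g y) = (\<Sum>x\<leftarrow>xs. \<Sum>y\<leftarrow>ys. f x * g y)" for f g :: "_ \<Rightarrow> complex"
  by (simp add: sum_list_mult_const[symmetric] sum_list_const_mult)

section \<open>Generated morphisms\<close>

text \<open>All that matters about \<open>I^+\<close> and \<open>I^-\<close> is where they send the highest weight vector, and there
only the coefficients at words beginning with \<open>0^{r-1}\<close>.\<close>
locale tl_extension = odd_root +
  fixes Ip Im :: mat and cp cm :: complex
  assumes hom_Ip: "is_hom r (r - 1) (2 * r - 1) Ip"
    and hom_Im: "is_hom r (r - 1) (2 * r - 1) Im"
    and cp: "cp \<noteq> 0" and cm: "cm \<noteq> 0"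
    and Ip_lead: "\<And>w. length w = 2 * r - 1 \<Longrightarrow>
      Ip w (replicate (r - 1) False) = (if w = replicate (2 * r - 1) False then cp else 0)"
    and Im_lead: "\<And>v u. length v = r \<Longrightarrow> length u = r - 1 \<Longrightarrow>
      mcomp (r - 1) Im jw (replicate (r - 1) False @ v) u
        = (if v = replicate r True \<and> u = replicate (r - 1) False then cm else 0)"
begin

text \<open>Linear combinations are part of the closure, so spans need not be pushed through
  compositions and tensor products along the way; \<open>generated_TLgen\<close> does this once.
  \<open>generated_cong\<close> identifies matrices that represent the same map.\<close>

inductive generated :: "nat \<Rightarrow> nat \<Rightarrow> mat \<Rightarrow> bool" where
  generated_idX: "generated 1 1 idX"
| generated_idC: "generated 0 0 idC"
| generated_c: "generated 0 2 (cmat r)"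
| generated_e: "generated 2 0 (emat r)"
| generated_Ip: "generated (r - 1) (2 * r - 1) Ip"
| generated_Im: "generated (r - 1) (2 * r - 1) Im"
| generated_comp: "generated m k A \<Longrightarrow> generated k n B \<Longrightarrow> generated m n (mcomp k B A)"
| generated_tensor: "generated m1 n1 A \<Longrightarrow> generated m2 n2 B \<Longrightarrow> generated (m1 + m2) (n1 + n2) (mtensor m1 n1 A B)"
| generated_add: "generated m n A \<Longrightarrow> generated m n B \<Longrightarrow> generated m n (\<lambda>w' w. A w' w + B w' w)"
| generated_smult: "generated m n A \<Longrightarrow> generated m n (\<lambda>w' w. c * A w' w)"
| generated_zero: "generated m n (\<lambda>w' w. 0)"
| generated_cong: "generated m n A \<Longrightarrow> mat_eq m n A B \<Longrightarrow> generated m n B"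

lemma is_hom_zero: "is_hom r m n (\<lambda>w' w. 0)"
  by (simp add: is_hom_def)

lemma generated_is_hom: "generated m n M \<Longrightarrow> is_hom r m n M"
proof (induction rule: generated.induct)
  case generated_idC
  have "idC = idX" by (intro ext) (simp add: idC_def idX_def)
  then show ?case by (simp add: is_hom_id)
qed (rule is_hom_id is_hom_cmat is_hom_emat hom_Ip hom_Im is_hom_zero is_hom_comp is_hom_tensor
       is_hom_add is_hom_smult is_hom_cong; assumption)+

lemma generated_congI: "generated m n A \<Longrightarrow> (\<And>w' w. length w' = n \<Longrightarrow> length w = m \<Longrightarrow> A w' w = B w' w) \<Longrightarrow> generated m n B"
  by (blast intro: generated_cong mat_eqI)

lemma generated_sum:
  assumes "finite S" "\<And>s. s \<in> S \<Longrightarrow> generated m n (M s)"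
  shows "generated m n (\<lambda>w' w. \<Sum>s\<in>S. c s * M s w' w)"
  using assms
proof (induction S rule: finite_induct)
  case empty then show ?case using generated_zero by simp
next
  case (insert s S)
  then show ?case using generated_add[OF generated_smult[of m n "M s" "c s"] insert(3)] by simp
qed

lemma generated_id: "generated n n idX"
proof (induction n)
  case 0
  have "idC = idX" by (intro ext) (simp add: idC_def idX_def)
  then show ?case using generated_idC by simp
next
  case (Suc n)
  have "generated (1 + n) (1 + n) (mtensor 1 1 idX idX)" by (rule generated_tensor[OF generated_idX Suc])
  then have "generated (Suc n) (Suc n) (mtensor 1 1 idX idX)" by simp
  then show ?case
  proof (rule generated_congI)
    fix w' w :: "bool list" assume "length w' = Suc n" "length w = Suc n"
    then show "mtensor 1 1 idX idX w' w = idX w' w"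
      by (cases w; cases w') (auto simp: idX_def)
  qed
qed

text \<open>The span of endomorphisms of X^k factoring through X^(k-2). Both halves of each
  factorization are recorded as generated, so that one of them can be absorbed into a morphism with
  fewer strands.\<close>

inductive cup_ideal :: "nat \<Rightarrow> mat \<Rightarrow> bool" where
  cup_ideal_base: "generated j (j + 2) A \<Longrightarrow> generated (j + 2) j B \<Longrightarrow> cup_ideal (j + 2) (mcomp j A B)"
| cup_ideal_add: "cup_ideal k A \<Longrightarrow> cup_ideal k B \<Longrightarrow> cup_ideal k (\<lambda>w' w. A w' w + B w' w)"
| cup_ideal_smult: "cup_ideal k A \<Longrightarrow> cup_ideal k (\<lambda>w' w. c * A w' w)"
| cup_ideal_zero: "cup_ideal k (\<lambda>w' w. 0)"
| cup_ideal_cong: "cup_ideal k A \<Longrightarrow> mat_eq k k A B \<Longrightarrow> cup_ideal k B"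

lemma cup_ideal_congI: "cup_ideal k A \<Longrightarrow> (\<And>w' w. length w' = k \<Longrightarrow> length w = k \<Longrightarrow> A w' w = B w' w) \<Longrightarrow> cup_ideal k B"
  by (blast intro: cup_ideal_cong mat_eqI)

lemma cup_ideal_tensor: "cup_ideal k M \<Longrightarrow> cup_ideal (Suc k) (mtensor 1 1 idX M)"
proof (induction rule: cup_ideal.induct)
  case (cup_ideal_base j A B)
  have "generated (1 + j) (1 + (j + 2)) (mtensor 1 1 idX A)" "generated (1 + (j + 2)) (1 + j) (mtensor 1 1 idX B)"
    using generated_tensor[OF generated_idX] cup_ideal_base by blast+
  then have "cup_ideal (Suc j + 2) (mcomp (Suc j) (mtensor 1 1 idX A) (mtensor 1 1 idX B))"
    by (intro cup_ideal.cup_ideal_base) simp_all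
  then have "cup_ideal (Suc (j + 2)) (mcomp (Suc j) (mtensor 1 1 idX A) (mtensor 1 1 idX B))" by simp
  then show ?case
  proof (rule cup_ideal_congI)
    fix w' w :: "bool list" assume "length w' = Suc (j + 2)" "length w = Suc (j + 2)"
    then obtain a u' b u where "w' = a # u'" "w = b # u" by (cases w'; cases w) auto
    then show "mcomp (Suc j) (mtensor 1 1 idX A) (mtensor 1 1 idX B) w' w = mtensor 1 1 idX (mcomp j A B) w' w"
      by (simp add: mcomp_def sum_twords_Suc idX_def)
  qed
next
  case (cup_ideal_add k A B)
  show ?case by (rule cup_ideal_cong[OF cup_ideal.cup_ideal_add[OF cup_ideal_add.IH]]) (simp add: mat_eq_def mtensor_def distrib_left)
next
  case (cup_ideal_smult k A c)
  show ?case by (rule cup_ideal_cong[OF cup_ideal.cup_ideal_smult[OF cup_ideal_smult.IH, of c]]) (simp add: mat_eq_def mtensor_def)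
next
  case (cup_ideal_zero k)
  show ?case by (rule cup_ideal_cong[OF cup_ideal.cup_ideal_zero]) (simp add: mat_eq_def mtensor_def)
next
  case (cup_ideal_cong k A B)
  show ?case by (rule cup_ideal.cup_ideal_cong[OF cup_ideal_cong.IH]) (use cup_ideal_cong.hyps in \<open>simp add: mat_eq_def mtensor_def\<close>)
qed

text \<open>Wenzl's recursion gives 1 - p_k = 1 \<otimes> (1 - p_{k-1}) - c P e_1 P. The first term
  lies in the ideal by induction and the second factors through X^(k-2), so both claims are proved
  together.\<close>

lemma jw_generated: "k < r \<Longrightarrow> generated k k jw \<and> cup_ideal k (\<lambda>w' w. idX w' w - jw w' w)"
proof (induction k rule: less_induct)
  case (less k)
  show ?case
  proof (cases "k \<le> 1")
    case True
    have "generated k k jw" by (rule generated_congI[OF generated_id]) (use True in \<open>simp add: jw_short idX_def\<close>)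
    moreover have "cup_ideal k (\<lambda>w' w. idX w' w - jw w' w)"
      by (rule cup_ideal_congI[OF cup_ideal_zero]) (use True in \<open>simp add: jw_short idX_def\<close>)
    ultimately show ?thesis by blast
  next
    case False
    define l where "l = k - 2"
    with False have k: "k = Suc (Suc l)" by simp
    with less have IH: "generated (Suc l) (Suc l) jw" "cup_ideal (Suc l) (\<lambda>w' w. idX w' w - jw w' w)" by auto
    let ?P = "mtensor 1 1 idX jw"
    \<comment> \<open>P e_1 P is cut open in the middle of e_1: \<open>?A\<close> is a cup followed
      by P, and \<open>?B\<close> is P followed by a cap.\<close>
    let ?A = "mcomp (Suc (Suc l)) ?P (mtensor 0 2 (cmat r) idX)"
    let ?B = "mcomp (Suc (Suc l)) (mtensor 2 0 (emat r) idX) ?P"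
    let ?c = "qn (Suc l) / qn (Suc (Suc l))"
    have P: "generated (Suc (Suc l)) (Suc (Suc l)) ?P" using generated_tensor[OF generated_idX IH(1)] by simp
    have A: "generated l (l + 2) ?A" using generated_comp[OF _ P] generated_tensor[OF generated_c generated_id[of l]] by simp
    have B: "generated (l + 2) l ?B" using generated_comp[OF P] generated_tensor[OF generated_e generated_id[of l]] by simp
    have Aent: "?A (x # u) s = cmat r [x, \<not> x] [] * jw u ((\<not> x) # s)"
      if "length u = Suc l" "length s = l" for x u s
    proof -
      have "?A (x # u) s = (\<Sum>t\<in>twords l. (cmat r [x, \<not> x] [] * jw u ((\<not> x) # t)) * idX t s)"
        unfolding mcomp_def sum_twords_Suc
        by (intro sum.cong refl) (use that in \<open>cases x; simp add: idX_def cmat_def\<close>)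
      then show ?thesis using that by simp
    qed
    have Bent: "?B s (x # u) = emat r [] [x, \<not> x] * jw ((\<not> x) # s) u"
      if "length u = Suc l" "length s = l" for x u s
    proof -
      have "?B s (x # u) = (\<Sum>t\<in>twords l. idX s t * (emat r [] [x, \<not> x] * jw ((\<not> x) # t) u))"
        unfolding mcomp_def sum_twords_Suc
        by (intro sum.cong refl) (use that in \<open>cases x; simp add: idX_def emat_def\<close>)
      then show ?thesis using that by simp
    qed
    have eq: "jw w' w = ?P w' w + ?c * mcomp l ?A ?B w' w" if "length w' = k" "length w = k" for w' w
    proof -
      obtain x' u' x u where w: "w' = x' # u'" "w = x # u" "length u' = Suc l" "length u = Suc l"
        using \<open>length w' = k\<close> \<open>length w = k\<close> k by (auto simp: length_Suc_conv)
      have "mcomp l ?A ?B w' w = cmat r [x', \<not> x'] [] * emat r [] [x, \<not> x]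
        * (\<Sum>s\<in>twords l. jw u' ((\<not> x') # s) * jw ((\<not> x) # s) u)"
        unfolding mcomp_def[of l] sum_distrib_left using w
        by (intro sum.cong refl) (simp only: mem_twords Aent Bent mult_ac)
      moreover have "?P w' w = (if x' = x then jw u' u else 0)" using w by (simp add: idX_def)
      ultimately show ?thesis using jw_Cons[of l u' u x' x] w k less.prems by simp
    qed
    have "generated k k jw"
      by (rule generated_congI[OF generated_add[OF _ generated_smult[of k k _ ?c]]])
         (use P generated_comp[OF B A] k eq in \<open>simp_all del: One_nat_def\<close>)
    moreover have "cup_ideal k (\<lambda>w' w. idX w' w - jw w' w)"
    proof (rule cup_ideal_congI)
      \<comment> \<open>The recursion for 1 - p_k: one strand beside the smaller complement, minus
        the correction term.\<close>
      show "cup_ideal k (\<lambda>w' w. mtensor 1 1 idX (\<lambda>w' w. idX w' w - jw w' w) w' w + (- ?c) * mcomp l ?A ?B w' w)"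
        using cup_ideal_add[OF cup_ideal_tensor[OF IH(2)] cup_ideal_smult[of _ _ "- ?c"]] cup_ideal_base[OF A B] k by simp
      fix w' w :: "bool list" assume l: "length w' = k" "length w = k"
      then obtain x' u' x u where w: "w' = x' # u'" "w = x # u"
        using k by (auto simp: length_Suc_conv)
      have "mtensor 1 1 idX (\<lambda>w' w. idX w' w - jw w' w) w' w = idX w' w - ?P w' w"
        unfolding w by (simp add: idX_def)
      then show "mtensor 1 1 idX (\<lambda>w' w. idX w' w - jw w' w) w' w + (- ?c) * mcomp l ?A ?B w' w = idX w' w - jw w' w"
        unfolding eq[OF l] by simp
    qed
    ultimately show ?thesis by blast
  qed
qed

section \<open>Bending strands between source and target\<close>

lemma mtensor_append_last:
  "length u = n \<Longrightarrow> length w = m \<Longrightarrow>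
    mtensor m (Suc n) A B (u @ [a, b]) (w @ [b']) = A (u @ [a]) w * B [b] [b']"
  "length u = n \<Longrightarrow> length w = m \<Longrightarrow>
    mtensor (Suc m) n A B (u @ [b']) (w @ [a, b]) = A u (w @ [a]) * B [b'] [b]"
  using mtensor_append[of "u @ [a]" "Suc n" w m A B "[b]" "[b']"]
    mtensor_append[of u n "w @ [a]" "Suc m" A B "[b']" "[b]"] by simp_all

definition bend :: "nat \<Rightarrow> nat \<Rightarrow> mat \<Rightarrow> mat" where
  "bend m n f = mcomp (n + 2) (mtensor n n idX (emat r)) (mtensor m (Suc n) f idX)"

definition unbend :: "nat \<Rightarrow> nat \<Rightarrow> mat \<Rightarrow> mat" where
  "unbend m n g = mcomp (m + 2) (mtensor (Suc m) n g idX) (mtensor m m idX (cmat r))"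

lemma sum_twords_2: "(\<Sum>v\<in>twords 2. f v) = f [False, False] + f [False, True] + f [True, False] + f [True, True]"
  by (simp add: numeral_2_eq_2 sum_twords_Suc add_ac)

lemma bend_entry:
  assumes "length w' = n" "length w = m"
  shows "bend m n f w' (w @ [b]) = f (w' @ [\<not> b]) w * emat r [] [\<not> b, b]"
proof -
  have "bend m n f w' (w @ [b]) = (\<Sum>u\<in>twords n. idX w' u *
     (\<Sum>v\<in>twords 2. emat r [] v * (mtensor m (Suc n) f idX (u @ v) (w @ [b]))))"
    unfolding bend_def mcomp_def sum_twords_append sum_distrib_left
    using assms mtensor_append[of w' n _ n idX "emat r" "[]"] by (intro sum.cong) simp_all
  also have "\<dots> = (\<Sum>v\<in>twords 2. emat r [] v * (mtensor m (Suc n) f idX (w' @ v) (w @ [b])))"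
    using assms by simp
  also have "\<dots> = f (w' @ [\<not> b]) w * emat r [] [\<not> b, b]"
    using assms by (cases b) (simp_all add: sum_twords_2 mtensor_append_last idX_def emat_def)
  finally show ?thesis .
qed

lemma unbend_entry:
  assumes "length w' = n" "length w = m"
  shows "unbend m n g (w' @ [a]) w = g w' (w @ [\<not> a]) * cmat r [\<not> a, a] []"
proof -
  have "unbend m n g (w' @ [a]) w = (\<Sum>u\<in>twords m. (\<Sum>v\<in>twords 2.
     (mtensor (Suc m) n g idX (w' @ [a]) (u @ v)) * cmat r v []) * idX u w)"
    unfolding unbend_def mcomp_def sum_twords_append sum_distrib_right
    using assms mtensor_append[of _ m w m idX "cmat r" _ "[]"] by (intro sum.cong) simp_all
  also have "\<dots> = (\<Sum>v\<in>twords 2. (mtensor (Suc m) n g idX (w' @ [a]) (w @ v)) * cmat r v [])"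
    using assms by simp
  also have "\<dots> = g w' (w @ [\<not> a]) * cmat r [\<not> a, a] []"
    using assms by (cases a) (simp_all add: sum_twords_2 mtensor_append_last idX_def cmat_def)
  finally show ?thesis .
qed

lemma bend_generated: "generated m (Suc n) f \<Longrightarrow> generated (Suc m) n (bend m n f)"
  unfolding bend_def using generated_comp[OF generated_tensor[OF _ generated_idX, of m "Suc n" f] ] generated_tensor[OF generated_id[of n] generated_e] by simp

lemma unbend_generated: "generated (Suc m) n g \<Longrightarrow> generated m (Suc n) (unbend m n g)"
  unfolding unbend_def using generated_comp[OF _ generated_tensor[OF _ generated_idX, of "Suc m" n g]] generated_tensor[OF generated_id[of m] generated_c] by simp

lemma bend_hom: "is_hom r m (Suc n) f \<Longrightarrow> is_hom r (Suc m) n (bend m n f)"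
  unfolding bend_def
  using is_hom_comp[OF is_hom_tensor[OF _ is_hom_id[of 1], of m "Suc n" f]]
    is_hom_tensor[OF is_hom_id[of n] is_hom_emat] by simp

lemma unbend_hom: "is_hom r (Suc m) n g \<Longrightarrow> is_hom r m (Suc n) (unbend m n g)"
  unfolding unbend_def
  using is_hom_comp[OF _ is_hom_tensor[OF _ is_hom_id[of 1], of "Suc m" n g]]
    is_hom_tensor[OF is_hom_id[of m] is_hom_cmat] by simp

definition full :: "nat \<Rightarrow> nat \<Rightarrow> bool" where
  "full m n \<longleftrightarrow> (\<forall>f. is_hom r m n f \<longrightarrow> generated m n f)"

lemma length_Suc_snoc: "length w = Suc n \<Longrightarrow> \<exists>u a. w = u @ [a] \<and> length u = n"
  by (simp add: length_Suc_conv_rev) blast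

text \<open>\<open>bend\<close> and \<open>unbend\<close> are mutually inverse by the zigzag
  identities; in entries these say that q times q^(-1) and (-1) times (-1) are 1. Both preserve
  module maps and generated maps.\<close>

lemma full_bend: "full m (Suc n) \<longleftrightarrow> full (Suc m) n"
proof
  assume full: "full m (Suc n)"
  show "full (Suc m) n" unfolding full_def
  proof (intro allI impI)
    fix g assume "is_hom r (Suc m) n g"
    then have "generated (Suc m) n (bend m n (unbend m n g))"
      using full by (auto simp: full_def intro: bend_generated unbend_hom)
    then show "generated (Suc m) n g"
    proof (rule generated_congI)
      fix w' w :: "bool list" assume l: "length w' = n" "length w = Suc m"
      then obtain u b where "w = u @ [b]" "length u = m" using length_Suc_snoc by blast
      then show "bend m n (unbend m n g) w' w = g w' w"
        using l by (cases b) (simp_all add: bend_entry unbend_entry cmat_def emat_def)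
    qed
  qed
next
  assume full: "full (Suc m) n"
  show "full m (Suc n)" unfolding full_def
  proof (intro allI impI)
    fix f assume "is_hom r m (Suc n) f"
    then have "generated m (Suc n) (unbend m n (bend m n f))"
      using full by (auto simp: full_def intro: unbend_generated bend_hom)
    then show "generated m (Suc n) f"
    proof (rule generated_congI)
      fix w' w :: "bool list" assume l: "length w' = Suc n" "length w = m"
      then obtain u b where "w' = u @ [b]" "length u = n" using length_Suc_snoc by blast
      then show "unbend m n (bend m n f) w' w = f w' w"
        using l by (cases b) (simp_all add: bend_entry unbend_entry cmat_def emat_def)
    qed
  qed
qed

lemma full_add: "full m (k + n) \<longleftrightarrow> full (k + m) n"
proof (induction k arbitrary: m)
  case (Suc k)
  then show ?case using full_bend[of m "k + n"] by simp
qed simp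

lemma full_iff: "m + n = m' + n' \<Longrightarrow> full m n \<longleftrightarrow> full m' n'"
  using full_add[of 0 m n] full_add[of 0 m' n'] by simp

section \<open>Compression of morphisms by Jones-Wenzl projections\<close>

definition sandwich :: "nat \<Rightarrow> nat \<Rightarrow> nat \<Rightarrow> mat \<Rightarrow> mat" where
  "sandwich k n m f = mcomp (k + n) (mtensor k k jw idX) (mcomp m f jw)"

lemma mtensor_idX_right_entry:
  assumes "length u = k'" "length w = n"
  shows "mcomp (k + n) (mtensor k k' M idX) f (u @ w) x = (\<Sum>y\<in>twords k. M u y * f (y @ w) x)"
  unfolding mcomp_def sum_twords_append
proof (intro sum.cong refl)
  fix y :: "bool list" assume "y \<in> twords k"
  then have "(\<Sum>v\<in>twords n. mtensor k k' M idX (u @ w) (y @ v) * f (y @ v) x)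
     = (\<Sum>v\<in>twords n. idX w v * (M u y * f (y @ v) x))"
    using assms by (intro sum.cong) simp_all
  then show "(\<Sum>v\<in>twords n. mtensor k k' M idX (u @ w) (y @ v) * f (y @ v) x) = M u y * f (y @ w) x"
    using assms by simp
qed

lemma mtensor_idX_left_entry:
  assumes "length u = k"
  shows "mcomp (k + n) (mtensor k k idX M) f (u @ w) x = (\<Sum>y\<in>twords n. M w y * f (u @ y) x)"
proof -
  have "mcomp (k + n) (mtensor k k idX M) f (u @ w) x
     = (\<Sum>z\<in>twords k. idX u z * (\<Sum>y\<in>twords n. M w y * f (z @ y) x))"
    unfolding mcomp_def sum_twords_append sum_distrib_left
    using assms by (intro sum.cong) simp_all
  then show ?thesis using assms by simp
qed

lemma sandwich_entry:
  assumes "length u = k" "length w = n"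
  shows "sandwich k n m f (u @ w) x = (\<Sum>y\<in>twords k. jw u y * (\<Sum>z\<in>twords m. f (y @ w) z * jw z x))"
  unfolding sandwich_def mtensor_idX_right_entry[OF assms] by (simp only: mcomp_def)

lemma sandwich_generated:
  assumes "k < r" "m < r" "generated m (k + n) f"
  shows "generated m (k + n) (sandwich k n m f)"
  unfolding sandwich_def
  using jw_generated[OF assms(1)] jw_generated[OF assms(2)] generated_comp assms(3) generated_tensor[OF _ generated_id[of n]] by blast

lemma sandwich_hom:
  assumes "k < r" "m < r" "is_hom r m (k + n) f"
  shows "is_hom r m (k + n) (sandwich k n m f)"
  unfolding sandwich_def
  using jw_generated[OF assms(1)] jw_generated[OF assms(2)] generated_is_hom is_hom_comp assms(3)
    is_hom_tensor[OF _ is_hom_id[of n]] by blast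

text \<open>The entries of \<open>jw\<close> carry a factor \<open>\<alpha>\<close> in each
  argument, which gives the compressed map the shape demanded by \<open>hom_sym_eq_0\<close>. Its
  leading coefficients are those of \<open>f\<close>, since the row and the column of
  \<open>jw\<close> at the highest weight word are unit vectors.\<close>

lemma sandwich_eq_0:
  assumes k: "k < r" and m: "m < r" and f: "is_hom r m (k + n) f"
    and 0: "\<And>w. length w = n \<Longrightarrow> f (replicate k False @ w) (replicate m False) = 0"
    and len: "length w = k + n" "length x = m"
  shows "sandwich k n m f w x = 0"
proof (rule hom_sym_eq_0[OF sandwich_hom[OF k m f] k m])
  fix u w x :: "bool list" assume l: "length u = k" "length w = n" "length x = m"
  show "sandwich k n m f (u @ w) x
     = (\<Sum>y\<in>twords k. (if ones u = ones y then \<alpha> y / qbin (zeros y) (ones y) else 0)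
          * (\<Sum>z\<in>twords m. f (y @ w) z * jw z x)) * \<alpha> u"
    unfolding sandwich_entry[OF l(1,2)] sum_distrib_right
    by (intro sum.cong) (simp_all add: jw_def)
next
  fix w x :: "bool list" assume l: "length w = k + n" "length x = m"
  \<comment> \<open>With \<open>zeros\<close> expressed by \<open>ones\<close>, the row factor
    depends on \<open>ones x\<close> alone, as the row hypothesis requires.\<close>
  have z: "zeros x = m - ones x" using zeros_plus_ones[of x] l by simp
  have "sandwich k n m f w x = (\<Sum>z\<in>twords m. mcomp (k + n) (mtensor k k jw idX) f w z * jw z x)"
    unfolding sandwich_def mcomp_assoc by (simp add: mcomp_def[of m])
  also have "\<dots> = (\<Sum>z\<in>twords m. mcomp (k + n) (mtensor k k jw idX) f w z
          * (if ones z = ones x then \<alpha> z / qbin (m - ones x) (ones x) else 0)) * \<alpha> x"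
    unfolding sum_distrib_right by (intro sum.cong) (simp_all add: jw_def z)
  finally show "sandwich k n m f w x = (\<Sum>z\<in>twords m. mcomp (k + n) (mtensor k k jw idX) f w z
          * (if ones z = ones x then \<alpha> z / qbin (m - ones x) (ones x) else 0)) * \<alpha> x" .
next
  fix w :: "bool list" assume l: "length w = n"
  have "sandwich k n m f (replicate k False @ w) (replicate m False)
    = (\<Sum>y\<in>twords k. (if y = replicate k False then 1 else 0)
        * (\<Sum>z\<in>twords m. f (y @ w) z * (if z = replicate m False then 1 else 0)))"
    using l k m by (simp add: sandwich_entry jw_replicate_False)
  then show "sandwich k n m f (replicate k False @ w) (replicate m False) = 0"
    using 0[OF l] by simp
qed (use len in simp_all)

text \<open>Applying \<open>sandwich_eq_0\<close> to f - t shows that \<open>f\<close> and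
  \<open>t\<close> have the same compression; that of \<open>t\<close> is visibly generated. It
  remains to find generated maps with prescribed leading coefficients.\<close>

lemma sandwich_generated_if_lead:
  assumes k: "k < r" and m: "m < r" and f: "is_hom r m (k + n) f" and t: "generated m (k + n) t"
    and lead: "\<And>w. length w = n \<Longrightarrow> t (replicate k False @ w) (replicate m False)
                  = f (replicate k False @ w) (replicate m False)"
  shows "generated m (k + n) (sandwich k n m f)"
proof (rule generated_congI[OF sandwich_generated[OF k m t]])
  fix w x :: "bool list" assume l: "length w = k + n" "length x = m"
  let ?h = "\<lambda>w x. f w x + (- 1) * t w x"
  have "sandwich k n m ?h w x = 0"
    by (rule sandwich_eq_0[OF k m is_hom_add[OF f is_hom_smult[OF generated_is_hom[OF t]]]])
       (use l lead in simp_all)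
  moreover from l obtain u v where "w = u @ v" "length u = k" "length v = n"
    by (auto elim: twords_split)
  ultimately show "sandwich k n m t w x = sandwich k n m f w x"
    by (simp add: sandwich_entry left_diff_distrib right_diff_distrib sum_subtractf)
qed

text \<open>For M = A B the map (B \<otimes> 1) f has target X^(k-2+n), where fullness is assumed,
  and A \<otimes> 1 is then applied to it. Fullness is guarded by k \<ge> 2 because the ideal
  contains the zero map for smaller k as well.\<close>

lemma cup_ideal_left:
  assumes "cup_ideal k M" "is_hom r m (k + n) f" "k \<ge> 2 \<Longrightarrow> full m (k - 2 + n)"
  shows "generated m (k + n) (mcomp (k + n) (mtensor k k M idX) f)"
  using assms
proof (induction rule: cup_ideal.induct)
  case (cup_ideal_base j A B)
  have A: "generated (j + n) (j + 2 + n) (mtensor j (j + 2) A idX)"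
    and B: "generated (j + 2 + n) (j + n) (mtensor (j + 2) j B idX)"
    using generated_tensor[OF _ generated_id[of n]] cup_ideal_base by blast+
  have "is_hom r m (j + n) (mcomp (j + 2 + n) (mtensor (j + 2) j B idX) f)"
    using is_hom_comp[OF cup_ideal_base(3) generated_is_hom[OF B]] .
  then have "generated m (j + n) (mcomp (j + 2 + n) (mtensor (j + 2) j B idX) f)"
    using cup_ideal_base(4) by (simp add: full_def)
  from generated_comp[OF this A] show ?case
  proof (rule generated_congI)
    fix w x :: "bool list" assume "length w = j + 2 + n"
    then obtain u v where w: "w = u @ v" "length u = j + 2" "length v = n" by (rule twords_split)
    show "mcomp (j + n) (mtensor j (j + 2) A idX) (mcomp (j + 2 + n) (mtensor (j + 2) j B idX) f) w x
      = mcomp (j + 2 + n) (mtensor (j + 2) (j + 2) (mcomp j A B) idX) f w x"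
    proof -
      have "mcomp (j + 2 + n) (mtensor (j + 2) j B idX) f (y @ v) x = (\<Sum>z\<in>twords (j + 2). B y z * f (z @ v) x)"
        if "y \<in> twords j" for y
        using that w by (simp only: mtensor_idX_right_entry mem_twords)
      then have "mcomp (j + n) (mtensor j (j + 2) A idX) (mcomp (j + 2 + n) (mtensor (j + 2) j B idX) f) w x
         = (\<Sum>y\<in>twords j. A u y * (\<Sum>z\<in>twords (j + 2). B y z * f (z @ v) x))"
        unfolding w(1) mtensor_idX_right_entry[OF w(2,3)] by (intro sum.cong refl) (simp only:)
      also have "\<dots> = (\<Sum>z\<in>twords (j + 2). mcomp j A B u z * f (z @ v) x)"
        unfolding mcomp_def sum_distrib_left sum_distrib_right mult.assoc by (rule sum.swap)
      finally show ?thesis unfolding w(1) mtensor_idX_right_entry[OF w(2,3)] .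
    qed
  qed
next
  case (cup_ideal_add k A B)
  show ?case
    by (rule generated_congI[OF generated_add[OF cup_ideal_add.IH(1) cup_ideal_add.IH(2)]])
       (use cup_ideal_add.prems in \<open>simp_all add: mcomp_def mtensor_def distrib_right sum.distrib\<close>)
next
  case (cup_ideal_smult k A c)
  show ?case
    by (rule generated_congI[OF generated_smult[OF cup_ideal_smult.IH, of c]])
       (use cup_ideal_smult.prems in \<open>simp_all add: mcomp_def mtensor_def sum_distrib_left mult.assoc\<close>)
next
  case (cup_ideal_zero k)
  show ?case
    by (rule generated_congI[OF generated_zero]) (simp add: mcomp_def mtensor_def)
next
  case (cup_ideal_cong k A B)
  have "mtensor k k A idX w u = mtensor k k B idX w u" if "length w = k + n" "length u = k + n" for w u
    using cup_ideal_cong.hyps(2) that by (simp add: mtensor_def mat_eq_def)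
  then show ?case
    by (intro generated_congI[OF cup_ideal_cong.IH[OF cup_ideal_cong.prems]]) (simp_all add: mcomp_def)
qed

lemma cup_ideal_right:
  assumes "cup_ideal m M" "is_hom r m n f" "m \<ge> 2 \<Longrightarrow> full (m - 2) n"
  shows "generated m n (mcomp m f M)"
  using assms
proof (induction rule: cup_ideal.induct)
  case (cup_ideal_base j A B)
  have "generated j n (mcomp (j + 2) f A)"
    using is_hom_comp[OF generated_is_hom[OF cup_ideal_base(1)] cup_ideal_base(3)] cup_ideal_base(4) by (simp add: full_def)
  from generated_comp[OF cup_ideal_base(2) this] show ?case by (simp only: mcomp_assoc)
next
  case (cup_ideal_add k A B)
  show ?case
    by (rule generated_congI[OF generated_add[OF cup_ideal_add.IH(1) cup_ideal_add.IH(2)]])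
       (use cup_ideal_add.prems in \<open>simp_all add: mcomp_def distrib_left sum.distrib\<close>)
next
  case (cup_ideal_smult k A c)
  show ?case
    by (rule generated_congI[OF generated_smult[OF cup_ideal_smult.IH, of c]])
       (use cup_ideal_smult.prems in \<open>simp_all add: mcomp_def sum_distrib_left mult.left_commute\<close>)
next
  case (cup_ideal_zero k)
  show ?case
    by (rule generated_congI[OF generated_zero]) (simp add: mcomp_def)
next
  case (cup_ideal_cong k A B)
  then show ?case
    by (intro generated_congI[OF cup_ideal_cong.IH[OF cup_ideal_cong.prems]]) (simp_all add: mcomp_def mat_eq_def)
qed

text \<open>With p_k standing for p_k \<otimes> 1, decompose f = p_k f p_m + p_k f (1 - p_m) + (1 -
  p_k) f. The last two terms factor through fewer strands.\<close>

lemma generated_if_sandwich: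
  assumes k: "k < r" and m: "m < r" and f: "is_hom r m (k + n) f"
    and full: "k \<ge> 2 \<Longrightarrow> full m (k - 2 + n)" "m \<ge> 2 \<Longrightarrow> full (m - 2) (k + n)"
    and s: "generated m (k + n) (sandwich k n m f)"
  shows "generated m (k + n) f"
proof -
  let ?D = "\<lambda>w' w. idX w' w - jw w' w"
  let ?pf = "mcomp (k + n) (mtensor k k jw idX) f"
  have J: "cup_ideal k ?D" "cup_ideal m ?D" and p: "generated k k jw" using jw_generated k m by blast+
  have "is_hom r m (k + n) ?pf"
    using is_hom_comp[OF f is_hom_tensor[OF generated_is_hom[OF p] is_hom_id]] .
  then have "generated m (k + n) (mcomp m ?pf ?D)" by (rule cup_ideal_right[OF J(2) _ full(2)])
  from generated_add[OF generated_add[OF s this] cup_ideal_left[OF J(1) f full(1)]] show ?thesis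
  proof (rule generated_congI)
    fix w x :: "bool list" assume l: "length w = k + n" "length x = m"
    then obtain u v where w: "w = u @ v" "length u = k" "length v = n" by (auto elim: twords_split)
    have "sandwich k n m f w x + mcomp m ?pf ?D w x = (\<Sum>z\<in>twords m. ?pf w z * idX z x)"
      unfolding sandwich_def mcomp_assoc by (simp add: mcomp_def[of m] right_diff_distrib sum_subtractf)
    also have "\<dots> = ?pf w x" using l by simp
    also have "\<dots> = (\<Sum>y\<in>twords k. jw u y * f (y @ v) x)"
      using w by (simp add: mtensor_idX_right_entry)
    finally have "sandwich k n m f w x + mcomp m ?pf ?D w x = (\<Sum>y\<in>twords k. jw u y * f (y @ v) x)" .
    moreover have "mcomp (k + n) (mtensor k k ?D idX) f w x = (\<Sum>y\<in>twords k. ?D u y * f (y @ v) x)"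
      using w by (simp only: mtensor_idX_right_entry)
    ultimately show "sandwich k n m f w x + mcomp m ?pf ?D w x + mcomp (k + n) (mtensor k k ?D idX) f w x = f w x"
      using w by (simp add: left_diff_distrib sum_subtractf)
  qed
qed

text \<open>Schur's lemma by leading coefficients: K forces k and m to agree modulo
  \<open>r\<close>, hence to be equal, and then a multiple of the identity has the right
  coefficient. The target is written k + 0 to fit the lemmas about k + n.\<close>

lemma sandwich_small:
  assumes k: "k < r" and m: "m < r" and f: "is_hom r m (k + 0) f"
  shows "generated m (k + 0) (sandwich k 0 m f)"
proof (cases "k = m")
  case True
  show ?thesis
    by (rule sandwich_generated_if_lead[OF k m f, of "\<lambda>w' w. f (replicate k False) (replicate m False) * idX w' w"])
       (use True generated_smult[OF generated_id] in \<open>simp_all add: idX_def\<close>)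
next
  case False
  have "f (replicate k False) (replicate m False) = 0"
  proof (rule ccontr)
    assume "f (replicate k False) (replicate m False) \<noteq> 0"
    then have "q powi int k = q powi int m"
      using is_homD(3)[OF f, of "replicate k False" "replicate m False"] by (simp add: wt_eq)
    then have "int r dvd int k - int m" using q_powi_eq_iff by blast
    then show False using False k m dvd_imp_le_int[of "int k - int m" "int r"] by auto
  qed
  then show ?thesis
    by (intro sandwich_generated_if_lead[OF k m f generated_zero]) simp
qed

section \<open>Leading words\<close>

definition attains :: "bool list \<Rightarrow> bool" where
  "attains w \<longleftrightarrow> (\<exists>f. generated (r - 1) (r - 1 + length w) f \<and>
     (\<forall>v. length v = length w \<longrightarrow>
        f (replicate (r - 1) False @ v) (replicate (r - 1) False) = (if v = w then 1 else 0)))"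

lemma attainsI:
  assumes "generated (r - 1) (r - 1 + n) f" "length w = n" "c \<noteq> 0"
    "\<And>v. length v = n \<Longrightarrow> f (replicate (r - 1) False @ v) (replicate (r - 1) False) = (if v = w then c else 0)"
  shows "attains w"
  unfolding attains_def
  by (rule exI[of _ "\<lambda>w' w. inverse c * f w' w"]) (use assms generated_smult in auto)

lemma attainsD:
  assumes "attains w" "length w = n"
  shows "\<exists>f. generated (r - 1) (r - 1 + n) f \<and> (\<forall>v. length v = n \<longrightarrow>
    f (replicate (r - 1) False @ v) (replicate (r - 1) False) = (if v = w then 1 else 0))"
  using assms(1) unfolding attains_def assms(2) .

text \<open>Apply 1 \<otimes> t after the map attaining \<open>w\<close>: the column of
  \<open>t\<close> at \<open>w\<close> has a single nonzero entry, so the leading coefficients move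
  to \<open>w'\<close>.\<close>

lemma attains_map:
  assumes "attains w" "length w = m" "generated m n t" "length w' = n" "c \<noteq> 0"
    and t: "\<And>v. length v = n \<Longrightarrow> t v w = (if v = w' then c else 0)"
  shows "attains w'"
proof -
  let ?Z = "replicate (r - 1) False"
  obtain f where f: "generated (r - 1) (r - 1 + m) f"
    "\<And>v. length v = m \<Longrightarrow> f (?Z @ v) ?Z = (if v = w then 1 else 0)"
    using attainsD[OF assms(1,2)] by blast
  show ?thesis
  proof (rule attainsI)
    show "generated (r - 1) (r - 1 + n) (mcomp (r - 1 + m) (mtensor (r - 1) (r - 1) idX t) f)"
      using generated_comp[OF f(1) generated_tensor[OF generated_id assms(3)]] .
    fix v :: "bool list" assume v: "length v = n"
    have "mcomp (r - 1 + m) (mtensor (r - 1) (r - 1) idX t) f (?Z @ v) ?Z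
      = (\<Sum>y\<in>twords m. t v y * (if y = w then 1 else 0))"
      unfolding mtensor_idX_left_entry[OF length_replicate]
      by (intro sum.cong) (simp_all del: One_nat_def add: f(2))
    then show "mcomp (r - 1 + m) (mtensor (r - 1) (r - 1) idX t) f (?Z @ v) ?Z = (if v = w' then c else 0)"
      using assms(2) t[OF v] by simp
  qed (use assms in auto)
qed

lemma attains_swap:
  assumes "attains (x @ [a, \<not> a] @ y)"
  shows "attains (x @ [\<not> a, a] @ y)"
proof -
  \<comment> \<open>Chosen to cancel the diagonal entry of c e at the word
    \<open>[a, \<not> a]\<close>; the entry that remains, at the exchanged word, is 1.\<close>
  define d where "d = (if a then inverse q else q)"
  define t where "t = (\<lambda>w' w. mcomp 0 (cmat r) (emat r) w' w + d * idX w' w)"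
  have t: "generated 2 2 t" unfolding t_def by (intro generated_add generated_smult generated_id generated_comp[OF generated_e generated_c])
  have tv: "t v [a, \<not> a] = (if v = [\<not> a, a] then 1 else 0)" if "length v = 2" for v
  proof -
    obtain b c where "v = [b, c]" using \<open>length v = 2\<close> by (auto simp: length_2_conv)
    then show ?thesis
      by (cases a; cases b; cases c) (simp_all add: t_def d_def mcomp_def cmat_def emat_def idX_def)
  qed
  let ?T = "mtensor (length x) (length x) idX (mtensor 2 2 t idX)"
  have T: "generated (length x + (2 + length y)) (length x + (2 + length y)) ?T"
    by (intro generated_tensor generated_id t)
  show ?thesis
  proof (rule attains_map[OF assms _ T, where c = 1])
    fix v :: "bool list" assume "length v = length x + (2 + length y)"
    then obtain x' v' where v: "v = x' @ v'" "length x' = length x" "length v' = 2 + length y"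
      by (rule twords_split)
    from v(3) obtain z y' where v': "v' = z @ y'" "length z = 2" "length y' = length y"
      by (rule twords_split)
    have "?T v (x @ [a, \<not> a] @ y) = idX x' x * (t z [a, \<not> a] * idX y' y)"
      using v v' mtensor_append[of z 2 "[a, \<not> a]" 2] by simp
    then show "?T v (x @ [a, \<not> a] @ y) = (if v = x @ [\<not> a, a] @ y then 1 else 0)"
      using v v' append_eq_append_conv[of z "[\<not> a, a]" y' y] by (auto simp: tv idX_def)
  qed auto
qed

lemma attains_swap_iff: "attains (x @ [a, \<not> a] @ y) \<longleftrightarrow> attains (x @ [\<not> a, a] @ y)"
  using attains_swap[of x a y] attains_swap[of x "\<not> a" y] by auto

lemma attains_move: "attains (x @ [False] @ replicate j True @ y) \<longleftrightarrow> attains (x @ replicate j True @ [False] @ y)"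
proof (induction j arbitrary: x)
  case (Suc j)
  have "attains (x @ [False] @ replicate (Suc j) True @ y)
      \<longleftrightarrow> attains ((x @ [True]) @ [False] @ replicate j True @ y)"
    using attains_swap_iff[of x False "replicate j True @ y"] by simp
  then show ?case using Suc[of "x @ [True]"] by simp
qed simp

text \<open>Exchanges of adjacent distinct letters are reversible, so only the numbers of ones and
  zeros matter; all ones are moved to the front.\<close>

lemma attains_sorted:
  "attains (x @ w) \<longleftrightarrow> attains (x @ replicate (ones w) True @ replicate (zeros w) False)"
proof (induction w arbitrary: x)
  case (Cons a w)
  then show ?case using Cons[of "x @ [a]"] attains_move[of x "ones w" "replicate (zeros w) False"]
    by (cases a) simp_all
qed simp

lemma nested_cups:
  "\<exists>C. generated 0 (2 * i) C \<and> (\<forall>v. length v = i \<longrightarrow>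
     C (replicate i False @ v) [] = (if v = replicate i True then q ^ i else 0))"
proof (induction i)
  case 0
  show ?case
  proof (intro exI[of _ idX] conjI)
    show "generated 0 (2 * 0) idX" using generated_id[of 0] by simp
  qed (simp add: idX_def)
next
  case (Suc i)
  then obtain C where C: "generated 0 (2 * i) C"
    "\<And>v. length v = i \<Longrightarrow> C (replicate i False @ v) [] = (if v = replicate i True then q ^ i else 0)"
    by blast
  \<comment> \<open>The new cup is outermost and joins the first and the last letter. A
    \<open>False\<close> in front forces a \<open>True\<close> at the end and contributes the
    coefficient q.\<close>
  let ?C = "mcomp 2 (mtensor 1 1 idX (mtensor 0 (2 * i) C idX)) (cmat r)"
  have "generated (1 + (0 + 1)) (1 + (2 * i + 1)) (mtensor 1 1 idX (mtensor 0 (2 * i) C idX))"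
    by (intro generated_tensor C generated_idX)
  then have "generated 0 (2 * Suc i) ?C"
    by (intro generated_comp[OF generated_c]) (simp add: numeral_2_eq_2)
  moreover have "?C (replicate (Suc i) False @ v) [] = (if v = replicate (Suc i) True then q ^ Suc i else 0)"
    if v: "length v = Suc i" for v
  proof -
    from v obtain u b where u: "v = u @ [b]" "length u = i" using length_Suc_snoc by blast
    have "mtensor 0 (2 * i) C idX (replicate i False @ u @ [b]) [b'] = C (replicate i False @ u) [] * idX [b] [b']" for b'
      using u mtensor_append[of "replicate i False @ u" "2 * i" "[]" 0 C idX "[b]" "[b']"] by simp
    then have "?C (replicate (Suc i) False @ v) [] = C (replicate i False @ u) [] * cmat r [False, b] []"
      using u by (cases b) (simp_all add: mcomp_def sum_twords_2 idX_def)
    then show ?thesis using u C(2)[of u]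
      by (cases b) (simp_all add: cmat_def flip: replicate_append_same)
  qed
  ultimately show ?case by blast
qed

lemma attains_base:
  assumes "i < r"
  shows "attains (replicate i True @ replicate i False)"
proof -
  let ?Z = "replicate (r - 1) False"
  \<comment> \<open>The map is j identity strands, i nested cups, then i identity strands. The
    prefix 0^(r-1) = 0^j 0^i covers the first strands and the left ends of the cups, whose right
    ends must then read 1^i; the last strands carry 0^i.\<close>
  define j where "j = r - 1 - i"
  have j: "r - 1 = j + i" using assms by (simp add: j_def)
  have Z: "?Z = replicate j False @ replicate i False" by (simp only: j replicate_add)
  obtain C where C: "generated 0 (2 * i) C"
    "\<And>v. length v = i \<Longrightarrow> C (replicate i False @ v) [] = (if v = replicate i True then q ^ i else 0)"
    using nested_cups by blast
  let ?f = "mtensor j j idX (mtensor 0 (2 * i) C idX)"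
  have "generated (j + (0 + i)) (j + (2 * i + i)) ?f" by (intro generated_tensor generated_id C)
  moreover have "j + (0 + i) = r - 1" "j + (2 * i + i) = r - 1 + 2 * i" using j by simp_all
  ultimately have "generated (r - 1) (r - 1 + 2 * i) ?f" by (simp only:)
  then show ?thesis
  proof (rule attainsI)
    fix v :: "bool list" assume "length v = 2 * i"
    then obtain v1 v2 where v: "v = v1 @ v2" "length v1 = i" "length v2 = i"
      by (auto simp: mult_2 elim: twords_split)
    have "?f (?Z @ v) ?Z = C (replicate i False @ v1) [] * idX v2 (replicate i False)"
      using v mtensor_append[of "replicate i False @ v1" "2 * i" "[]" 0 C idX v2 "replicate i False"]
      by (simp del: One_nat_def add: Z idX_def)
    then show "?f (?Z @ v) ?Z = (if v = replicate i True @ replicate i False then q ^ i else 0)"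
      using v C(2) by (simp add: idX_def)
  qed simp_all
qed

text \<open>I^+ comes first: it sends the highest weight word of X^(r-1) to a multiple of 0^(2r-1).
  The map attaining \<open>w\<close> then acts on the first r - 1 strands and leaves 0^r at the
  end.\<close>

lemma attains_append:
  assumes "attains w"
  shows "attains (w @ replicate r False)"
proof -
  let ?Z = "replicate (r - 1) False"
  have r2: "r - 1 + r = 2 * r - 1" using r_ge_3 by simp
  obtain f where f: "generated (r - 1) (r - 1 + length w) f"
    "\<And>v. length v = length w \<Longrightarrow> f (?Z @ v) ?Z = (if v = w then 1 else 0)"
    using attainsD[OF assms refl] by blast
  have Z2: "replicate (2 * r - 1) False = ?Z @ replicate r False"
    by (simp only: r2 flip: replicate_add)
  let ?f = "mtensor (r - 1) (r - 1 + length w) f idX"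
  have "generated (r - 1 + r) (r - 1 + (length w + r)) ?f"
    using generated_tensor[OF f(1) generated_id[of r]] by (simp only: add.assoc)
  then have "generated (r - 1) (r - 1 + (length w + r)) (mcomp (2 * r - 1) ?f Ip)"
    unfolding r2 by (rule generated_comp[OF generated_Ip])
  then show ?thesis
  proof (rule attainsI)
    fix v :: "bool list" assume "length v = length w + r"
    then obtain v1 v2 where v: "v = v1 @ v2" "length v1 = length w" "length v2 = r"
      by (rule twords_split)
    have "mcomp (2 * r - 1) ?f Ip (?Z @ v) ?Z
        = (\<Sum>u\<in>twords (2 * r - 1). (?f (?Z @ v) u * cp) * (if u = replicate (2 * r - 1) False then 1 else 0))"
      unfolding mcomp_def by (intro sum.cong) (simp_all del: One_nat_def add: Ip_lead)
    also have "\<dots> = ?f (?Z @ v) (?Z @ replicate r False) * cp"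
      by (simp del: One_nat_def add: Z2 r2)
    also have "\<dots> = f (?Z @ v1) ?Z * idX v2 (replicate r False) * cp"
      using v mtensor_append[of "?Z @ v1" "r - 1 + length w" ?Z "r - 1" f idX v2 "replicate r False"] by simp
    finally show "mcomp (2 * r - 1) ?f Ip (?Z @ v) ?Z = (if v = w @ replicate r False then cp else 0)"
      using v f(2)[of v1] by (simp add: idX_def)
  qed (simp_all add: cp)
qed

text \<open>I^- p_{r-1} comes last, on the first r - 1 strands of the output. By
  \<open>Im_lead\<close> it contributes to the prefix 0^(r-1) only from the input 0^(r-1), and
  inserts 1^r behind that prefix.\<close>

lemma attains_prepend:
  assumes "attains w"
  shows "attains (replicate r True @ w)"
proof -
  let ?Z = "replicate (r - 1) False"
  have r2: "2 * r - 1 = r - 1 + r" using r_ge_3 by simp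
  obtain f where f: "generated (r - 1) (r - 1 + length w) f"
    "\<And>v. length v = length w \<Longrightarrow> f (?Z @ v) ?Z = (if v = w then 1 else 0)"
    using attainsD[OF assms refl] by blast
  let ?I = "mcomp (r - 1) Im jw"
  let ?f = "mtensor (r - 1) (2 * r - 1) ?I idX"
  have "generated (r - 1) (r - 1) jw" using jw_generated[of "r - 1"] r_ge_3 by simp
  then have "generated (r - 1 + length w) (2 * r - 1 + length w) ?f"
    by (intro generated_tensor generated_id generated_comp[OF _ generated_Im])
  moreover have "2 * r - 1 + length w = r - 1 + (r + length w)" using r2 by simp
  ultimately have "generated (r - 1) (r - 1 + (r + length w)) (mcomp (r - 1 + length w) ?f f)"
    using generated_comp[OF f(1)] by (simp only:)
  then show ?thesis
  proof (rule attainsI)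
    fix v :: "bool list" assume "length v = r + length w"
    then obtain v1 v2 where v: "v = v1 @ v2" "length v1 = r" "length v2 = length w"
      by (rule twords_split)
    have "mcomp (r - 1 + length w) ?f f (?Z @ v) ?Z = (\<Sum>y\<in>twords (r - 1). ?I (?Z @ v1) y * f (y @ v2) ?Z)"
      using v mtensor_idX_right_entry[of "?Z @ v1" "2 * r - 1" v2 "length w" "r - 1" ?I f ?Z] by (simp add: r2)
    also have "\<dots> = (\<Sum>y\<in>twords (r - 1). (if y = ?Z then 1 else 0)
        * ((if v1 = replicate r True then cm else 0) * f (y @ v2) ?Z))"
      using v by (intro sum.cong) (simp_all del: One_nat_def add: Im_lead)
    also have "\<dots> = (if v1 = replicate r True then cm else 0) * f (?Z @ v2) ?Z"
      by simp
    finally show "mcomp (r - 1 + length w) ?f f (?Z @ v) ?Z = (if v = replicate r True @ w then cm else 0)"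
      using v f(2)[of v2] by simp
  qed (simp_all add: cm)
qed

lemma attains_all:
  assumes "int r dvd wt w"
  shows "attains w"
proof -
  have "int (zeros w) mod int r = int (ones w) mod int r"
    using assms by (simp add: wt_eq mod_eq_dvd_iff)
  \<comment> \<open>Zeros and ones have the same remainder i modulo \<open>r\<close>. The sorted
    word is therefore 1^i 0^i with blocks 1^r prepended and blocks 0^r appended.\<close>
  then have eq: "zeros w mod r = ones w mod r" by (metis of_nat_mod of_nat_eq_iff)
  define i where "i = ones w mod r"
  have a: "attains (replicate i True @ replicate i False @ replicate (c * r) False)" for c
  proof (induction c)
    case 0
    then show ?case using attains_base[of i] r_ge_3 by (simp add: i_def)
  next
    case (Suc c)
    have "replicate (Suc c * r) False = replicate (c * r) False @ replicate r False"
      by (simp add: add.commute flip: replicate_add)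
    then show ?case using attains_append[OF Suc] by simp
  qed
  have b: "attains (replicate (b * r) True @ replicate i True @ replicate i False @ replicate (c * r) False)" for b c
  proof (induction b)
    case (Suc b)
    have "replicate (Suc b * r) True = replicate r True @ replicate (b * r) True"
      by (simp add: replicate_add)
    then show ?case using attains_prepend[OF Suc] by simp
  qed (simp add: a)
  have "ones w = ones w div r * r + i" by (simp add: i_def)
  moreover have "zeros w = i + zeros w div r * r"
    unfolding i_def eq[symmetric] by (rule mod_div_mult_eq[symmetric])
  ultimately have "replicate (ones w) True = replicate (ones w div r * r) True @ replicate i True"
    "replicate (zeros w) False = replicate i False @ replicate (zeros w div r * r) False"
    by (metis replicate_add)+
  then show ?thesis using b attains_sorted[of "[]" w] by simp
qed

text \<open>K-equivariance restricts the leading coefficients of \<open>f\<close> to words of weight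
  divisible by \<open>r\<close>, all of which are attained. The attaining maps, weighted by these
  coefficients, add up to a generated map with the same leading coefficients.\<close>

lemma sandwich_large:
  assumes f: "is_hom r (r - 1) (r - 1 + n) f"
  shows "generated (r - 1) (r - 1 + n) (sandwich (r - 1) n (r - 1) f)"
proof -
  let ?Z = "replicate (r - 1) False"
  let ?S = "{w \<in> twords n. int r dvd wt w}"
  have "\<forall>w\<in>?S. \<exists>g. generated (r - 1) (r - 1 + n) g \<and>
      (\<forall>v. length v = n \<longrightarrow> g (?Z @ v) ?Z = (if v = w then 1 else 0))"
    using attainsD[OF attains_all] by simp
  then obtain g where g': "\<forall>w\<in>?S. generated (r - 1) (r - 1 + n) (g w) \<and>
      (\<forall>v. length v = n \<longrightarrow> g w (?Z @ v) ?Z = (if v = w then 1 else 0))"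
    by (rule bchoice[THEN exE])
  have g: "generated (r - 1) (r - 1 + n) (g w)" if "w \<in> ?S" for w
    using g' that by blast
  have g2: "g w (?Z @ v) ?Z = (if v = w then 1 else 0)" if "w \<in> ?S" "length v = n" for w v
    using g' that by blast
  have fin: "finite ?S" by (rule finite_subset[OF _ finite_twords[of n]]) auto
  have r1: "r - 1 < r" using r_ge_3 by simp
  show ?thesis
  proof (rule sandwich_generated_if_lead[OF r1 r1 f])
    show "generated (r - 1) (r - 1 + n) (\<lambda>w' x. \<Sum>w\<in>?S. f (?Z @ w) ?Z * g w w' x)"
      by (rule generated_sum[OF fin g])
    fix v :: "bool list" assume v: "length v = n"
    have "f (?Z @ v) ?Z = 0" if "v \<notin> ?S"
    proof (rule ccontr)
      assume "f (?Z @ v) ?Z \<noteq> 0"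
      then have "q powi (wt ?Z + wt v) = q powi wt ?Z"
        using is_homD(3)[OF f, of "?Z @ v" ?Z] v by simp
      then have "int r dvd wt v" using q_powi_eq_iff by fastforce
      then show False using that v by simp
    qed
    moreover have "(\<Sum>w\<in>?S. f (?Z @ w) ?Z * g w (?Z @ v) ?Z)
        = (\<Sum>w\<in>?S. f (?Z @ w) ?Z * (if v = w then 1 else 0))"
      by (intro sum.cong refl) (simp only: g2[OF _ v])
    ultimately show "(\<Sum>w\<in>?S. f (?Z @ w) ?Z * g w (?Z @ v) ?Z) = f (?Z @ v) ?Z"
      using fin sum_delta_mult(3)[of ?S "\<lambda>w. f (?Z @ w) ?Z" v] by (simp del: sum_delta_mult mem_Collect_eq)
  qed
qed

theorem full_all: "full m n"
proof -
  have "m + n = N \<Longrightarrow> full m n" for N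
  proof (induction N arbitrary: m n rule: less_induct)
    case (less N)
    have IH: "full m' n'" if "m' + n' < N" for m' n' using less.IH that by blast
    show ?case
    proof (cases "N \<le> 2 * (r - 1)")
      case True
      \<comment> \<open>The most even split keeps both numbers of strands below \<open>r\<close>, so
        that both projections exist.\<close>
      define m' k where "m' = N div 2" and "k = N - N div 2"
      have N: "m' < r" "k < r" "m' + k = N" using True r_ge_3 by (auto simp: m'_def k_def)
      have "full m' (k + 0)" unfolding full_def
      proof (intro allI impI)
        fix f assume f: "is_hom r m' (k + 0) f"
        show "generated m' (k + 0) f"
          by (rule generated_if_sandwich[OF N(2,1) f _ _ sandwich_small[OF N(2,1) f]]) (use N in \<open>auto intro!: IH\<close>)
      qed
      then show ?thesis using full_iff[of m n m' k] less.prems N by simp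
    next
      case False
      \<comment> \<open>Both projections get size r - 1, the largest for which
        \<open>jw_generated\<close> applies, and l further target strands are left over.\<close>
      define l where "l = N - 2 * (r - 1)"
      have N: "(r - 1) + (r - 1 + l) = N" "r - 1 < r" using False r_ge_3 by (auto simp: l_def)
      have "full (r - 1) (r - 1 + l)" unfolding full_def
      proof (intro allI impI)
        fix f assume f: "is_hom r (r - 1) (r - 1 + l) f"
        show "generated (r - 1) (r - 1 + l) f"
          by (rule generated_if_sandwich[OF N(2,2) f _ _ sandwich_large[OF f]]) (use N in \<open>auto intro!: IH\<close>)
      qed
      then show ?thesis using full_iff[of m n "r - 1" "r - 1 + l"] less.prems N by simp
    qed
  qed
  then show ?thesis by blast
qed

section \<open>Expansion of generated maps into linear combinations\<close>

lemma generated_TLgen: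
  assumes "generated m n M"
  shows "\<exists>cs. (\<forall>(a, N)\<in>set cs. (m, n, N) \<in> TLgen r Pp Pm Ip Im) \<and>
    (\<forall>w\<in>twords m. \<forall>w'\<in>twords n. M w' w = (\<Sum>(a, N)\<leftarrow>cs. a * N w' w))"
  (is "\<exists>cs. ?P m n M cs")
  using assms
proof (induction rule: generated.induct)
  case (generated_comp m k A n B)
  then obtain as bs where A: "?P m k A as" and B: "?P k n B bs" by blast
  \<comment> \<open>Composition is bilinear: one term for each pair of summands. The tensor product
    is treated in the same way.\<close>
  let ?cs = "concat (map (\<lambda>(b, B). map (\<lambda>(a, A). (b * a, mcomp k B A)) as) bs)"
  have "?P m n (mcomp k B A) ?cs"
  proof (intro conjI ballI)
    fix z assume "z \<in> set ?cs"
    then obtain a A b B where z: "z = (b * a, mcomp k B A)" and "(a, A) \<in> set as" "(b, B) \<in> set bs"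
      by auto
    then have "(m, k, A) \<in> TLgen r Pp Pm Ip Im" "(k, n, B) \<in> TLgen r Pp Pm Ip Im"
      using A B by auto
    then show "case z of (a, N) \<Rightarrow> (m, n, N) \<in> TLgen r Pp Pm Ip Im"
      unfolding z by (auto intro: TLgen.g_comp)
  next
    fix w w' assume w: "w \<in> twords m" "w' \<in> twords n"
    have "mcomp k B A w' w = (\<Sum>u\<in>twords k. (\<Sum>(b, B)\<leftarrow>bs. b * B w' u) * (\<Sum>(a, A)\<leftarrow>as. a * A u w))"
      unfolding mcomp_def using A B w by (intro sum.cong refl arg_cong2[where f="(*)"]) blast+
    also have "\<dots> = (\<Sum>x\<leftarrow>bs. \<Sum>y\<leftarrow>as. fst x * fst y * mcomp k (snd x) (snd y) w' w)"
      unfolding sum_list_mult_sum_list sum_sum_list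
      by (simp only: split_def mcomp_def sum_distrib_left mult_ac)
    also have "\<dots> = (\<Sum>(c, N)\<leftarrow>?cs. c * N w' w)"
      unfolding sum_list_concat_map by (simp add: split_def comp_def)
    finally show "mcomp k B A w' w = (\<Sum>(c, N)\<leftarrow>?cs. c * N w' w)" .
  qed
  then show ?case by blast
next
  case (generated_tensor m1 n1 A m2 n2 B)
  then obtain as bs where A: "?P m1 n1 A as" and B: "?P m2 n2 B bs" by blast
  let ?cs = "concat (map (\<lambda>(a, A). map (\<lambda>(b, B). (a * b, mtensor m1 n1 A B)) bs) as)"
  have "?P (m1 + m2) (n1 + n2) (mtensor m1 n1 A B) ?cs"
  proof (intro conjI ballI)
    fix z assume "z \<in> set ?cs"
    then obtain a A b B where z: "z = (a * b, mtensor m1 n1 A B)" and "(a, A) \<in> set as" "(b, B) \<in> set bs"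
      by auto
    then have "(m1, n1, A) \<in> TLgen r Pp Pm Ip Im" "(m2, n2, B) \<in> TLgen r Pp Pm Ip Im"
      using A B by auto
    then show "case z of (a, N) \<Rightarrow> (m1 + m2, n1 + n2, N) \<in> TLgen r Pp Pm Ip Im"
      unfolding z by (auto intro: TLgen.g_tensor)
  next
    fix w w' assume w: "w \<in> twords (m1 + m2)" "w' \<in> twords (n1 + n2)"
    have "take m1 w \<in> twords m1" "take n1 w' \<in> twords n1" "drop m1 w \<in> twords m2" "drop n1 w' \<in> twords n2"
      using w by simp_all
    then have "mtensor m1 n1 A B w' w = (\<Sum>(a, A)\<leftarrow>as. a * A (take n1 w') (take m1 w))
        * (\<Sum>(b, B)\<leftarrow>bs. b * B (drop n1 w') (drop m1 w))"
      unfolding mtensor_def using A B by (intro arg_cong2[where f="(*)"]) blast+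
    also have "\<dots> = (\<Sum>x\<leftarrow>as. \<Sum>y\<leftarrow>bs. fst x * fst y * mtensor m1 n1 (snd x) (snd y) w' w)"
      unfolding sum_list_mult_sum_list by (simp only: split_def mtensor_def mult_ac)
    also have "\<dots> = (\<Sum>(c, N)\<leftarrow>?cs. c * N w' w)"
      unfolding sum_list_concat_map by (simp add: split_def comp_def)
    finally show "mtensor m1 n1 A B w' w = (\<Sum>(c, N)\<leftarrow>?cs. c * N w' w)" .
  qed
  then show ?case by blast
next
  case (generated_add m n A B)
  then obtain as bs where "?P m n A as" "?P m n B bs" by blast
  then have "?P m n (\<lambda>w' w. A w' w + B w' w) (as @ bs)" by (simp add: ball_Un)
  then show ?case by blast
next
  case (generated_smult m n A c)
  then obtain as where "?P m n A as" by blast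
  then have "?P m n (\<lambda>w' w. c * A w' w) (map (\<lambda>(a, N). (c * a, N)) as)"
    by (auto simp: case_prod_beta comp_def mult.assoc sum_list_const_mult)
  then show ?case by blast
next
  case (generated_zero m n)
  show ?case by (rule exI[of _ "[]"]) simp
next
  case (generated_cong m n A B)
  then obtain as where "?P m n A as" by blast
  then have "?P m n B as" using generated_cong.hyps(2) by (simp add: mat_eq_def)
  then show ?case by blast
next
  case generated_idX
  show ?case by (rule exI[of _ "[(1, idX)]"]) (simp add: TLgen.g_idX del: One_nat_def)
next
  case generated_idC
  show ?case by (rule exI[of _ "[(1, idC)]"]) (simp add: TLgen.g_idC)
next
  case generated_c
  show ?case by (rule exI[of _ "[(1, cmat r)]"]) (simp add: TLgen.g_c)
next
  case generated_e
  show ?case by (rule exI[of _ "[(1, emat r)]"]) (simp add: TLgen.g_e)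
next
  case generated_Ip
  show ?case by (rule exI[of _ "[(1, Ip)]"]) (simp add: TLgen.g_Ip del: One_nat_def)
next
  case generated_Im
  show ?case by (rule exI[of _ "[(1, Im)]"]) (simp add: TLgen.g_Im del: One_nat_def)
qed

end

section \<open>Submodules and the maps \<open>I^+\<close>, \<open>I^-\<close>\<close>

lemma app_mem_Vsp [simp]: "app m n M v \<in> Vsp n"
  by (simp add: app_def Vsp_def)

lemma app_lin: "app m n M (\<lambda>w. a * u w + b * v w) = (\<lambda>w. a * app m n M u w + b * app m n M v w)"
  by (simp add: app_def fun_eq_iff distrib_left sum.distrib sum_distrib_left mult.left_commute)

lemma Vsp_lin: "u \<in> Vsp m \<Longrightarrow> v \<in> Vsp m \<Longrightarrow> (\<lambda>w. a * u w + b * v w) \<in> Vsp m"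
  by (simp add: Vsp_def)

lemma bvec_mem_Vsp: "length w = m \<Longrightarrow> bvec w \<in> Vsp m"
  by (auto simp: Vsp_def bvec_def)

lemma submodule_lin:
  assumes W: "is_submodule r m W" and uv: "u \<in> W" "v \<in> W"
  shows "(\<lambda>w. a * u w + b * v w) \<in> W"
proof -
  have add: "\<forall>u\<in>W. \<forall>v\<in>W. (\<lambda>w. u w + v w) \<in> W"
    using W unfolding is_submodule_def by (elim conjE)
  have smult: "\<forall>a. \<forall>v\<in>W. (\<lambda>w. a * v w) \<in> W"
    using W unfolding is_submodule_def by (elim conjE)
  show ?thesis
    by (rule add[rule_format, OF smult[rule_format, OF uv(1)] smult[rule_format, OF uv(2)]])
qed

lemma submodule_act:
  assumes W: "is_submodule r m W" and g: "g \<in> {Emat, Fmat, Kmat}" and v: "v \<in> W"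
  shows "app m m (g r m) v \<in> W"
proof -
  have "\<forall>g\<in>actions r m. \<forall>v\<in>W. app m m g v \<in> W"
    using W unfolding is_submodule_def by (elim conjE)
  moreover have "g r m \<in> actions r m" using g by (auto simp: actions_def)
  ultimately show ?thesis using v by (simp only:)
qed

lemma modgen_submodule:
  assumes "S \<subseteq> Vsp m"
  shows "is_submodule r m (modgen r m S)"
proof -
  have "v \<in> Vsp m" if "v \<in> modgen r m S" for v
    using that
  proof (induction rule: modgen.induct)
    case (base v)
    then show ?case using assms by blast
  qed (simp_all add: Vsp_def app_def)
  then show ?thesis unfolding is_submodule_def
    by (intro conjI subsetI ballI allI modgen.zero modgen.add modgen.smult modgen.act)
qed

text \<open>Treats I^+ and I^- at once, with \<open>W\<close> as X^+ or X^- and \<open>X\<close> as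
  X_{r-1}. Since \<open>inv_into W \<theta>\<close> inverts \<open>\<theta>\<close> only on
  \<open>X\<close>, the facts about it carry membership in \<open>X\<close>.\<close>

locale submodule_embedding =
  fixes r N k :: nat and W X :: "vec set" and \<theta> :: "vec \<Rightarrow> vec" and \<phi> :: mat
  assumes iso: "is_mod_iso r N k W X \<theta>" and sub: "is_submodule r N W"
    and \<phi>_hom: "is_hom r k k \<phi>" and \<phi>_idem: "idempotent_end k \<phi>" and \<phi>_im: "mimage k k \<phi> = X"
begin

abbreviation \<psi> :: "vec \<Rightarrow> vec" where "\<psi> \<equiv> inv_into W \<theta>"

definition I :: mat where "I w' w = \<psi> (app k k \<phi> (bvec w)) w'"

lemma X_lin: "u \<in> X \<Longrightarrow> v \<in> X \<Longrightarrow> (\<lambda>w. a * u w + b * v w) \<in> X"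
  unfolding \<phi>_im[symmetric] mimage_def by (auto simp flip: app_lin intro!: imageI Vsp_lin)

lemma app_X: "x \<in> X \<Longrightarrow> app k k \<phi> x = x"
  unfolding \<phi>_im[symmetric] mimage_def using \<phi>_idem by (auto simp: idempotent_end_def)

lemma app_mem_X: "v \<in> Vsp k \<Longrightarrow> app k k \<phi> v \<in> X"
  unfolding \<phi>_im[symmetric] mimage_def by blast

lemma bij: "bij_betw \<theta> W X"
  using iso by (simp add: is_mod_iso_def)

lemma \<psi>_mem: "x \<in> X \<Longrightarrow> \<psi> x \<in> W"
  using bij by (metis bij_betw_def inv_into_into)

lemma \<theta>_\<psi>: "x \<in> X \<Longrightarrow> \<theta> (\<psi> x) = x"
  using bij by (metis bij_betw_def f_inv_into_f)

lemma \<psi>_eqI: "w \<in> W \<Longrightarrow> \<theta> w = x \<Longrightarrow> \<psi> x = w"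
  using bij by (auto simp: bij_betw_def)

lemma \<psi>_lin:
  assumes "u \<in> X" "v \<in> X"
  shows "\<psi> (\<lambda>w. a * u w + b * v w) = (\<lambda>w. a * \<psi> u w + b * \<psi> v w)"
proof (rule \<psi>_eqI)
  show "(\<lambda>w. a * \<psi> u w + b * \<psi> v w) \<in> W"
    by (rule submodule_lin[OF sub]) (use assms \<psi>_mem in auto)
  have "\<theta> (\<lambda>w. a * \<psi> u w + b * \<psi> v w) = (\<lambda>w. a * \<theta> (\<psi> u) w + b * \<theta> (\<psi> v) w)"
    using iso \<psi>_mem[OF assms(1)] \<psi>_mem[OF assms(2)] unfolding is_mod_iso_def by blast
  then show "\<theta> (\<lambda>w. a * \<psi> u w + b * \<psi> v w) = (\<lambda>w. a * u w + b * v w)"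
    by (simp add: \<theta>_\<psi> assms)
qed

lemma zero_X: "(\<lambda>_. 0) \<in> X"
  using app_mem_X[of "\<lambda>_. 0"] X_lin[of _ _ 0 0] by (simp add: Vsp_def app_def)

lemma \<psi>_zero: "\<psi> (\<lambda>_. 0) = (\<lambda>_. 0)"
  using \<psi>_lin[OF zero_X zero_X, of 0 0] by simp

lemma \<psi>_nonzero:
  assumes "x \<in> X" "x \<noteq> (\<lambda>_. 0)"
  shows "\<psi> x \<noteq> (\<lambda>_. 0)"
  using assms \<theta>_\<psi>[OF assms(1)] \<theta>_\<psi>[OF zero_X] by (auto simp: \<psi>_zero)

text \<open>Linearity of \<open>\<psi>\<close> is known only on \<open>X\<close>, so membership of
  the partial sums has to be carried through the induction.\<close>

lemma \<psi>_sum: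
  assumes "finite S" "\<And>u. u \<in> S \<Longrightarrow> f u \<in> X"
  shows "(\<lambda>w. \<Sum>u\<in>S. c u * f u w) \<in> X \<and> \<psi> (\<lambda>w. \<Sum>u\<in>S. c u * f u w) = (\<lambda>w. \<Sum>u\<in>S. c u * \<psi> (f u) w)"
  using assms
proof (induction S rule: finite_induct)
  case empty
  then show ?case by (simp add: zero_X \<psi>_zero)
next
  case (insert s S)
  then show ?case
    using X_lin[of "f s" "\<lambda>w. \<Sum>u\<in>S. c u * f u w" "c s" 1]
      \<psi>_lin[of "f s" "\<lambda>w. \<Sum>u\<in>S. c u * f u w" "c s" 1] by simp
qed

lemma app_bvec: "length u = k \<Longrightarrow> app k k M (bvec u) w = (if length w = k then M w u else 0)"
  by (simp add: app_def bvec_def)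

lemma sum_I:
  "(\<Sum>u\<in>twords k. I w' u * v u) = \<psi> (app k k \<phi> v) w'"
proof -
  have "app k k \<phi> v = (\<lambda>w. \<Sum>u\<in>twords k. v u * app k k \<phi> (bvec u) w)"
    by (auto simp: fun_eq_iff app_bvec app_def[of k k \<phi> v] intro!: sum.cong)
  then have "\<psi> (app k k \<phi> v) = (\<lambda>w. \<Sum>u\<in>twords k. v u * \<psi> (app k k \<phi> (bvec u)) w)"
    using \<psi>_sum[of "twords k" "\<lambda>u. app k k \<phi> (bvec u)" v] by (simp add: app_mem_X bvec_mem_Vsp)
  then show ?thesis by (simp add: I_def mult.commute)
qed

lemma \<psi>_act:
  assumes g: "g \<in> {Emat, Fmat, Kmat}" and x: "x \<in> X"
  shows "\<psi> (app k k (g r k) x) = app N N (g r N) (\<psi> x)"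
proof (rule \<psi>_eqI)
  show "app N N (g r N) (\<psi> x) \<in> W" by (rule submodule_act[OF sub g \<psi>_mem[OF x]])
  have "\<theta> (app N N (g r N) (\<psi> x)) = app k k (g r k) (\<theta> (\<psi> x))"
    using iso g \<psi>_mem[OF x] unfolding is_mod_iso_def by blast
  then show "\<theta> (app N N (g r N) (\<psi> x)) = app k k (g r k) x" by (simp only: \<theta>_\<psi>[OF x])
qed

lemma hom_I: "is_hom r k N I"
  unfolding is_hom_def
proof (intro ballI)
  fix g :: "nat \<Rightarrow> nat \<Rightarrow> mat" and w' w
  assume g: "g \<in> {Emat, Fmat, Kmat}" and w: "w' \<in> twords N" "w \<in> twords k"
  let ?x = "app k k \<phi> (bvec w)"
  have x: "?x \<in> X" using w by (intro app_mem_X bvec_mem_Vsp) simp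
  have "(\<Sum>u\<in>twords N. g r N w' u * I u w) = app N N (g r N) (\<psi> ?x) w'"
    using w by (simp add: app_def I_def)
  also have "\<dots> = \<psi> (app k k (g r k) ?x) w'" by (simp only: \<psi>_act[OF g x])
  \<comment> \<open>Equivariance of \<open>\<phi>\<close> moves \<open>g\<close> inside, where it
    becomes column \<open>w\<close> of its matrix; \<open>sum_I\<close> then recognizes a product
    with \<open>I\<close>.\<close>
  also have "app k k (g r k) ?x = app k k \<phi> (\<lambda>u. g r k u w)"
  proof
    fix y
    show "app k k (g r k) ?x y = app k k \<phi> (\<lambda>u. g r k u w) y"
    proof (cases "length y = k")
      case True
      then have "y \<in> twords k" by simp
      have "app k k (g r k) ?x y = (\<Sum>u\<in>twords k. g r k y u * \<phi> u w)"
        using w True by (simp add: app_def[of k k "g r k"] app_bvec)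
      also have "\<dots> = (\<Sum>u\<in>twords k. \<phi> y u * g r k u w)"
        using \<phi>_hom g w \<open>y \<in> twords k\<close> unfolding is_hom_def by blast
      finally show ?thesis using True by (simp add: app_def)
    qed (simp add: app_def)
  qed
  also have "\<psi> (app k k \<phi> (\<lambda>u. g r k u w)) w' = (\<Sum>u\<in>twords k. I w' u * g r k u w)"
    by (simp only: sum_I)
  finally show "(\<Sum>u\<in>twords N. g r N w' u * I u w) = (\<Sum>u\<in>twords k. I w' u * g r k u w)" .
qed

end

section \<open>Symmetric vectors and the leading coefficients of I^+ and I^-\<close>

context odd_root begin

text \<open>The divided power F^j / [j]! of the highest weight vector for j < r; for n < r and j
  \<le> n these vectors form the weight basis of X_n.\<close>

definition sv :: "nat \<Rightarrow> nat \<Rightarrow> vec" where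
  "sv n j = (\<lambda>u. if length u = n \<and> ones u = j then \<alpha> u else 0)"

lemma allzero_eq: "allzero n = sv n 0"
  by (auto simp: allzero_def bvec_def sv_def fun_eq_iff ones_eq_0_iff)

lemma Fmat_sv: "app n n (Fmat r n) (sv n j) = (\<lambda>w. qn (Suc j) * sv n (Suc j) w)"
proof
  fix w
  show "app n n (Fmat r n) (sv n j) w = qn (Suc j) * sv n (Suc j) w"
  proof (cases "length w = n")
    case True
    then have "app n n (Fmat r n) (sv n j) w = Fact (\<lambda>u. (if ones u = j then 1 else 0) * \<alpha> u) w"
      by (simp add: app_def sum_Fmat) (rule act_cong, simp add: sv_def)
    also have "\<dots> = (if ones w - 1 = j then 1 else 0) * qn (ones w) * \<alpha> w"
      by (rule Fact_sym)
    finally show ?thesis using True by (cases "ones w") (auto simp: sv_def)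
  qed (simp add: app_def sv_def)
qed

lemma Fmat_power_allzero: "(app n n (Fmat r n) ^^ j) (allzero n) = (\<lambda>w. qfact j * sv n j w)"
proof (induction j)
  case 0
  then show ?case by (simp add: allzero_eq)
next
  case (Suc j)
  have "app n n (Fmat r n) (\<lambda>w. qfact j * sv n j w) = (\<lambda>w. qfact j * app n n (Fmat r n) (sv n j) w)"
    using app_lin[of n n "Fmat r n" "qfact j" "sv n j" 0 "\<lambda>_. 0"] by simp
  then show ?case using Suc by (simp add: Fmat_sv mult.assoc)
qed

lemma sv_mem_Xsimple:
  assumes "j \<le> n" "n < r"
  shows "sv n j \<in> Xsimple r n"
proof -
  have "(\<lambda>w. qfact j * sv n j w) \<in> Xsimple r n"
    unfolding Xsimple_def Fmat_power_allzero[symmetric] using assms by (intro lspan.base) blast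
  then have "(\<lambda>w. inverse (qfact j) * (qfact j * sv n j w)) \<in> Xsimple r n"
    unfolding Xsimple_def by (rule lspan.smult)
  then show ?thesis using qfact_nonzero[of j] assms by (simp flip: mult.assoc)
qed

text \<open>Symmetric vectors avoiding the weight spaces in which the number of ones satisfies
  \<open>P\<close>; used to separate X^+ from X^- inside X^(2r-1).\<close>

definition sym_space :: "nat \<Rightarrow> (nat \<Rightarrow> bool) \<Rightarrow> vec set" where
  "sym_space n P = {v. \<exists>b. (\<forall>j. P j \<longrightarrow> b j = 0) \<and> v = (\<lambda>w. if length w = n then b (ones w) * \<alpha> w else 0)}"

lemma sym_spaceI:
  "(\<And>j. P j \<Longrightarrow> b j = 0) \<Longrightarrow> (\<And>w. v w = (if length w = n then b (ones w) * \<alpha> w else 0)) \<Longrightarrow> v \<in> sym_space n P"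
  unfolding sym_space_def by blast

text \<open>E moves the coefficient for j + 1 ones to j ones with the factor [n - j], and F moves
  the one for j to j + 1 with the factor [j + 1]. The action enters the forbidden region only where
  such a factor vanishes.\<close>

lemma sym_space_act:
  assumes v: "v \<in> sym_space n P" and g: "g \<in> actions r n"
    and up: "\<And>j. P j \<Longrightarrow> P (Suc j) \<or> qn (n - j) = 0" and down: "\<And>j. P (Suc j) \<Longrightarrow> P j \<or> qn (Suc j) = 0"
  shows "app n n g v \<in> sym_space n P"
proof -
  obtain b where b: "\<forall>j. P j \<longrightarrow> b j = 0" "v = (\<lambda>w. if length w = n then b (ones w) * \<alpha> w else 0)"
    using v unfolding sym_space_def by blast
  have z: "zeros w = n - ones w" if "length w = n" for w using zeros_plus_ones[of w] that by simp
  consider "g = Emat r n" | "g = Fmat r n" | "g = Kmat r n" using g by (auto simp: actions_def)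
  then show ?thesis
  proof cases
    case 1
    show ?thesis
    proof (rule sym_spaceI[where b = "\<lambda>j. b (Suc j) * qn (n - j)"])
      fix w
      have "Eact v w = Eact (\<lambda>u. b (ones u) * \<alpha> u) w" if "length w = n"
        using that b by (intro act_cong) simp
      then show "app n n g v w = (if length w = n then b (Suc (ones w)) * qn (n - ones w) * \<alpha> w else 0)"
        by (simp add: 1 app_def sum_Emat Eact_sym z)
    qed (use up b(1) in auto)
  next
    case 2
    show ?thesis
    proof (rule sym_spaceI[where b = "\<lambda>j. b (j - 1) * qn j"])
      fix w
      have "Fact v w = Fact (\<lambda>u. b (ones u) * \<alpha> u) w" if "length w = n"
        using that b by (intro act_cong) simp
      then show "app n n g v w = (if length w = n then b (ones w - 1) * qn (ones w) * \<alpha> w else 0)"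
        by (simp add: 2 app_def sum_Fmat Fact_sym)
    next
      fix j assume "P j"
      then show "b (j - 1) * qn j = 0" using down b(1) by (cases j) auto
    qed
  next
    case 3
    show ?thesis
    proof (rule sym_spaceI[where b = "\<lambda>j. q ^ (n - j) * inverse q ^ j * b j"])
      fix w
      show "app n n g v w = (if length w = n then q ^ (n - ones w) * inverse q ^ ones w * b (ones w) * \<alpha> w else 0)"
        by (simp add: 3 app_def sum_Kmat powi_wt z b)
    qed (use b(1) in auto)
  qed
qed

lemma modgen_sym_space:
  assumes "S \<subseteq> sym_space n P"
    and "\<And>j. P j \<Longrightarrow> P (Suc j) \<or> qn (n - j) = 0" "\<And>j. P (Suc j) \<Longrightarrow> P j \<or> qn (Suc j) = 0"
  shows "modgen r n S \<subseteq> sym_space n P"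
proof
  fix v assume "v \<in> modgen r n S"
  then show "v \<in> sym_space n P"
  proof (induction rule: modgen.induct)
    case zero
    then show ?case by (intro sym_spaceI[where b = "\<lambda>_. 0"]) simp_all
  next
    case (add u v)
    from add.IH(1) obtain a where a: "\<forall>j. P j \<longrightarrow> a j = 0" "u = (\<lambda>w. if length w = n then a (ones w) * \<alpha> w else 0)"
      unfolding sym_space_def by blast
    from add.IH(2) obtain b where b: "\<forall>j. P j \<longrightarrow> b j = 0" "v = (\<lambda>w. if length w = n then b (ones w) * \<alpha> w else 0)"
      unfolding sym_space_def by blast
    show ?case
      by (rule sym_spaceI[where b = "\<lambda>j. a j + b j"]) (simp_all add: a b distrib_right)
  next
    case (smult v c)
    from smult.IH obtain b where b: "\<forall>j. P j \<longrightarrow> b j = 0" "v = (\<lambda>w. if length w = n then b (ones w) * \<alpha> w else 0)"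
      unfolding sym_space_def by blast
    show ?case
      by (rule sym_spaceI[where b = "\<lambda>j. c * b j"]) (simp_all add: b mult.assoc)
  qed (use assms sym_space_act in blast)+
qed

lemma qn_r [simp]: "qn r = 0"
  by (simp add: qn_eq_0_iff)

lemma ones_eq_length_iff: "length w = n \<Longrightarrow> ones w = n \<longleftrightarrow> w = replicate n True"
proof (induction w arbitrary: n)
  case (Cons x w)
  then show ?case using ones_le_length[of w] by auto
qed simp

lemma \<alpha>_replicate_True [simp]: "\<alpha> (replicate n True) = 1"
  by (induction n) auto

text \<open>The generator has no ones, and F passes from r - 1 to r ones with the factor [r] =
  0.\<close>

lemma Xplus_sym: "Xplus r \<subseteq> sym_space (2 * r - 1) (\<lambda>j. r \<le> j)"
  unfolding Xplus_def
proof (rule modgen_sym_space)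
  have "allzero (2 * r - 1) \<in> sym_space (2 * r - 1) (\<lambda>j. r \<le> j)"
    using r_ge_3 by (intro sym_spaceI[where b = "\<lambda>j. if j = 0 then 1 else 0"]) (auto simp: allzero_eq sv_def)
  then show "{allzero (2 * r - 1)} \<subseteq> sym_space (2 * r - 1) (\<lambda>j. r \<le> j)" by simp
  fix j assume "r \<le> Suc j"
  then have "r \<le> j \<or> Suc j = r" by linarith
  then show "r \<le> j \<or> qn (Suc j) = 0" using qn_r by metis
qed auto

text \<open>The generator has 2r - 1 ones, and E passes from r to r - 1 ones with the factor
  [(2r - 1) - (r - 1)] = [r] = 0.\<close>

lemma Xminus_sym: "Xminus r \<subseteq> sym_space (2 * r - 1) (\<lambda>j. j < r)"
  unfolding Xminus_def
proof (rule modgen_sym_space)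
  have "allone (2 * r - 1) \<in> sym_space (2 * r - 1) (\<lambda>j. j < r)"
    using r_ge_3
    by (intro sym_spaceI[where b = "\<lambda>j. if j = 2 * r - 1 then 1 else 0"])
       (auto simp: allone_def bvec_def ones_eq_length_iff simp del: One_nat_def)
  then show "{allone (2 * r - 1)} \<subseteq> sym_space (2 * r - 1) (\<lambda>j. j < r)" by simp
  fix j assume "j < r"
  then have "Suc j < r \<or> 2 * r - 1 - j = r" by linarith
  then show "Suc j < r \<or> qn (2 * r - 1 - j) = 0" using qn_r by metis
qed auto

lemma Xplus_submodule: "is_submodule r (2 * r - 1) (Xplus r)"
  unfolding Xplus_def allzero_def by (intro modgen_submodule) (simp add: bvec_mem_Vsp)

lemma Xminus_submodule: "is_submodule r (2 * r - 1) (Xminus r)"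
  unfolding Xminus_def allone_def by (intro modgen_submodule) (simp add: bvec_mem_Vsp)

text \<open>The weight of \<open>K\<close> determines \<open>ones w\<close> modulo \<open>r\<close> because \<open>r\<close> is odd.\<close>
lemma sv_weight:
  assumes emb: "submodule_embedding r (2 * r - 1) (r - 1) W (Xsimple r (r - 1)) \<theta> \<phi>"
    and j: "j < r" and w: "length w = 2 * r - 1" "inv_into W \<theta> (sv (r - 1) j) w \<noteq> 0"
  shows "ones w mod r = j"
proof -
  interpret submodule_embedding r "2 * r - 1" "r - 1" W "Xsimple r (r - 1)" \<theta> \<phi> by (rule emb)
  have X: "sv (r - 1) j \<in> Xsimple r (r - 1)" using j by (intro sv_mem_Xsimple) auto
  let ?e = "int (r - 1) - 2 * int j"
  have "app (r - 1) (r - 1) (Kmat r (r - 1)) (sv (r - 1) j) = (\<lambda>w. q powi ?e * sv (r - 1) j w)"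
  proof
    fix u
    have "wt u = int (length u) - 2 * int (ones u)" using zeros_plus_ones[of u] by (simp add: wt_eq)
    then show "app (r - 1) (r - 1) (Kmat r (r - 1)) (sv (r - 1) j) u = q powi ?e * sv (r - 1) j u"
      by (auto simp: app_def sum_Kmat sv_def)
  qed
  then have "app (2 * r - 1) (2 * r - 1) (Kmat r (2 * r - 1)) (\<psi> (sv (r - 1) j)) w = q powi ?e * \<psi> (sv (r - 1) j) w"
    using \<psi>_act[of Kmat, OF _ X] \<psi>_lin[OF X zero_X, of "q powi ?e" 0] by simp
  then have "q powi wt w = q powi ?e" using w by (simp add: app_def sum_Kmat)
  then have "int r dvd wt w - ?e" using q_powi_eq_iff by blast
  \<comment> \<open>The two tensor powers differ by \<open>r\<close> factors, which does not matter
    modulo \<open>r\<close>.\<close>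
  also have "wt w - ?e = int r + 2 * (int j - int (ones w))"
    using zeros_plus_ones[of w] w r_ge_3 by (simp add: wt_eq)
  finally have "int r dvd 2 * (int j - int (ones w))" by simp
  moreover have "coprime (int r) 2" using odd_r by simp
  ultimately have "int r dvd int j - int (ones w)" by (simp only: coprime_dvd_mult_right_iff)
  then have "int j mod int r = int (ones w) mod int r" by (simp add: mod_eq_dvd_iff)
  then show ?thesis using j by (metis of_nat_mod of_nat_eq_iff mod_less)
qed

text \<open>A word in the image of the highest weight vector has fewer than \<open>r\<close> ones by
  \<open>Xplus_sym\<close> and a multiple of \<open>r\<close> ones by its weight, hence none. The
  remaining coefficient is nonzero because the embedding is injective.\<close>

lemma Xplus_lead:
  assumes emb: "submodule_embedding r (2 * r - 1) (r - 1) (Xplus r) (Xsimple r (r - 1)) \<theta> \<phi>"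
  shows "\<exists>c. c \<noteq> 0 \<and> (\<forall>w. length w = 2 * r - 1 \<longrightarrow>
    Imat r (Xplus r) \<theta> \<phi> w (replicate (r - 1) False) = (if w = replicate (2 * r - 1) False then c else 0))"
proof -
  interpret submodule_embedding r "2 * r - 1" "r - 1" "Xplus r" "Xsimple r (r - 1)" \<theta> \<phi> by (rule emb)
  let ?x = "sv (r - 1) 0"
  have r0: "0 < r" using r_ge_3 by simp
  have x: "?x \<in> Xsimple r (r - 1)" using r0 by (intro sv_mem_Xsimple) auto
  have "\<psi> ?x \<in> sym_space (2 * r - 1) (\<lambda>j. r \<le> j)" using \<psi>_mem[OF x] Xplus_sym by blast
  then obtain b where b: "\<forall>j. r \<le> j \<longrightarrow> b j = 0"
    "\<psi> ?x = (\<lambda>w. if length w = 2 * r - 1 then b (ones w) * \<alpha> w else 0)"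
    unfolding sym_space_def by blast
  have w: "w = replicate (2 * r - 1) False" if "length w = 2 * r - 1" "\<psi> ?x w \<noteq> 0" for w
  proof -
    have "ones w mod r = 0" by (rule sv_weight[OF emb r0 that])
    moreover have "ones w < r" using b that by (metis mult_zero_left not_le)
    ultimately have "ones w = 0" by simp
    then show ?thesis using ones_eq_0_iff[of w] that by simp
  qed
  have I0: "Imat r (Xplus r) \<theta> \<phi> w (replicate (r - 1) False) = \<psi> ?x w" for w
    using app_X[OF x] by (simp add: Imat_def allzero_eq[symmetric] allzero_def)
  obtain w0 where "\<psi> ?x w0 \<noteq> 0"
  proof -
    have "?x (replicate (r - 1) False) \<noteq> 0" by (simp add: sv_def)
    then have "?x \<noteq> (\<lambda>_. 0)" by (metis (no_types))
    then show thesis using \<psi>_nonzero[OF x] that by blast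
  qed
  moreover from this have "length w0 = 2 * r - 1" by (auto simp: b(2) simp del: One_nat_def split: if_splits)
  ultimately have "\<psi> ?x (replicate (2 * r - 1) False) \<noteq> 0" using w by metis
  then show ?thesis unfolding I0 using w by (intro exI[of _ "\<psi> ?x (replicate (2 * r - 1) False)"]) auto
qed

text \<open>Words in the images have at least \<open>r\<close> ones. After the prefix 0^(r-1) only
  \<open>r\<close> letters remain, so all are ones; the weight then leaves only the highest weight
  vector as source.\<close>

lemma Xminus_lead:
  assumes emb: "submodule_embedding r (2 * r - 1) (r - 1) (Xminus r) (Xsimple r (r - 1)) \<theta> \<phi>"
  shows "\<exists>c. c \<noteq> 0 \<and> (\<forall>v u. length v = r \<longrightarrow> length u = r - 1 \<longrightarrow>
    mcomp (r - 1) (Imat r (Xminus r) \<theta> \<phi>) jw (replicate (r - 1) False @ v) u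
      = (if v = replicate r True \<and> u = replicate (r - 1) False then c else 0))"
proof -
  interpret submodule_embedding r "2 * r - 1" "r - 1" "Xminus r" "Xsimple r (r - 1)" \<theta> \<phi> by (rule emb)
  let ?Z = "replicate (r - 1) False"
  have r0: "0 < r" and r1: "r - 1 < r" and r2: "2 * r - 1 = r - 1 + r" using r_ge_3 by simp_all
  have x: "sv (r - 1) j \<in> Xsimple r (r - 1)" if "j < r" for j
    using that by (intro sv_mem_Xsimple) auto
  have sym: "\<exists>b. (\<forall>i. i < r \<longrightarrow> b i = 0) \<and>
      \<psi> (sv (r - 1) j) = (\<lambda>w. if length w = 2 * r - 1 then b (ones w) * \<alpha> w else 0)" if "j < r" for j
    using \<psi>_mem[OF x[OF that]] Xminus_sym unfolding sym_space_def by blast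
  have low: "r \<le> ones w \<and> ones w mod r = j"
    if "length w = 2 * r - 1" "j < r" "\<psi> (sv (r - 1) j) w \<noteq> 0" for w j
    using sym[OF that(2)] sv_weight[OF emb that(2,1,3)] that by (metis mult_zero_left not_le)
  have lead: "v = replicate r True \<and> j = 0"
    if "length v = r" "j < r" "\<psi> (sv (r - 1) j) (?Z @ v) \<noteq> 0" for v j
  proof -
    have "r \<le> ones v" "ones v mod r = j" using low[of "?Z @ v" j] that r2 by simp_all
    moreover have "ones v \<le> r" using ones_le_length[of v] that by simp
    ultimately have "ones v = r" "j = 0" by auto
    then show ?thesis using ones_eq_length_iff[of v r] that by simp
  qed
  \<comment> \<open>Column \<open>u\<close> of \<open>jw\<close> is a multiple of
    \<open>sv (r - 1) (ones u)\<close>, which \<open>\<phi>\<close> fixes.\<close>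
  have entry: "mcomp (r - 1) (Imat r (Xminus r) \<theta> \<phi>) jw w u
      = \<alpha> u / qbin (zeros u) (ones u) * \<psi> (sv (r - 1) (ones u)) w" if "length u = r - 1" for w u
  proof -
    let ?d = "\<alpha> u / qbin (zeros u) (ones u)"
    have j: "ones u < r" using ones_le_length[of u] that r1 by simp
    \<comment> \<open>The summand 0 * 0 gives the column the two-term form of \<open>app_lin\<close>
      and \<open>\<psi>_lin\<close>.\<close>
    have "mcomp (r - 1) (Imat r (Xminus r) \<theta> \<phi>) jw w u = (\<Sum>y\<in>twords (r - 1). I w y * (?d * sv (r - 1) (ones u) y + 0 * 0))"
      unfolding mcomp_def by (intro sum.cong) (simp_all add: I_def Imat_def jw_def sv_def del: One_nat_def)
    also have "\<dots> = \<psi> (\<lambda>w. ?d * sv (r - 1) (ones u) w + 0 * 0) w"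
      unfolding sum_I app_lin app_X[OF x[OF j]] app_X[OF zero_X] ..
    also have "\<dots> = ?d * \<psi> (sv (r - 1) (ones u)) w"
      unfolding \<psi>_lin[OF x[OF j] zero_X] by simp
    finally show ?thesis .
  qed
  let ?c = "\<psi> (sv (r - 1) 0) (?Z @ replicate r True)"
  have "?c \<noteq> 0"
  proof -
    obtain b where b: "\<forall>i. i < r \<longrightarrow> b i = 0"
      "\<psi> (sv (r - 1) 0) = (\<lambda>w. if length w = 2 * r - 1 then b (ones w) * \<alpha> w else 0)"
      using sym[OF r0] by blast
    have "sv (r - 1) 0 ?Z \<noteq> 0" by (simp add: sv_def)
    then have "sv (r - 1) 0 \<noteq> (\<lambda>_. 0)" by (metis (no_types))
    then obtain w where w: "\<psi> (sv (r - 1) 0) w \<noteq> 0"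
      using \<psi>_nonzero[OF x[OF r0]] by blast
    then have l: "length w = 2 * r - 1" by (auto simp: b(2) simp del: One_nat_def split: if_splits)
    \<comment> \<open>The number of ones is a multiple of \<open>r\<close> between r and 2r - 1,
      hence equal to \<open>r\<close>. So b r is nonzero, and it also governs the coefficient at
      0^(r-1) 1^r.\<close>
    from low[OF l r0 w] obtain t where "r \<le> ones w" "ones w = t * r" by (auto elim: dvdE)
    moreover have "ones w \<le> 2 * r - 1" using ones_le_length[of w] l by simp
    then have "ones w < 2 * r" using r0 by linarith
    ultimately have "t < 2" "t > 0" using r0 by (auto intro: gr0I)
    then have "ones w = r" using \<open>ones w = t * r\<close> by (cases t) auto
    then have "b r \<noteq> 0" using w l by (auto simp: b(2) simp del: One_nat_def)
    then show ?thesis using r2 by (simp add: b(2) del: One_nat_def)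
  qed
  moreover have "mcomp (r - 1) (Imat r (Xminus r) \<theta> \<phi>) jw (?Z @ v) u
      = (if v = replicate r True \<and> u = ?Z then ?c else 0)" if l: "length v = r" "length u = r - 1" for v u
  proof (cases "\<psi> (sv (r - 1) (ones u)) (?Z @ v) = 0")
    case True
    then show ?thesis using \<open>?c \<noteq> 0\<close> by (auto simp: entry[OF l(2)] l simp del: One_nat_def)
  next
    case False
    have "ones u < r" using ones_le_length[of u] l r1 by simp
    then have "v = replicate r True" "ones u = 0" using lead[OF l(1) _ False] by blast+
    then have "v = replicate r True" "u = ?Z" using ones_eq_0_iff[of u] l by simp_all
    then show ?thesis using r0 by (simp add: entry del: One_nat_def)
  qed
  ultimately show ?thesis by (intro exI[of _ ?c]) blast
qed

end
theorem theorem1p1: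
  fixes r :: nat
    and Y1 Y2 :: "vec set"
    and \<phi> \<rho>p \<rho>m :: mat
    and \<theta>p \<theta>m :: "vec \<Rightarrow> vec"
  assumes r_odd: "odd r" and r_ge: "r \<ge> 3"
    \<comment> \<open>Y_{r-1}: the submodule complement of X_{r-1} in X^{\<otimes>(r-1)}\<close>
    and Y1_sub: "is_submodule r (r-1) Y1"
    and Y1_compl: "\<forall>v\<in>Vsp (r-1). \<exists>!(x, y). x \<in> Xsimple r (r-1) \<and> y \<in> Y1 \<and> v = (\<lambda>w. x w + y w)"
    \<comment> \<open>Y_{2r-1}: the submodule with X^{\<otimes>(2r-1)} = X^+ \<oplus> X^- \<oplus> Y_{2r-1}\<close>
    and Y2_sub: "is_submodule r (2*r-1) Y2"
    and Y2_compl: "\<forall>v\<in>Vsp (2*r-1). \<exists>!(x, x', y). x \<in> Xplus r \<and> x' \<in> Xminus r \<and> y \<in> Y2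
                      \<and> v = (\<lambda>w. x w + x' w + y w)"
    \<comment> \<open>\<phi>_{r-1}\<close>
    and \<phi>_hom: "is_hom r (r-1) (r-1) \<phi>" and \<phi>_idem: "idempotent_end (r-1) \<phi>"
    and \<phi>_im: "mimage (r-1) (r-1) \<phi> = Xsimple r (r-1)" and \<phi>_ker: "mkernel (r-1) (r-1) \<phi> = Y1"
    \<comment> \<open>\<rho>^+\<close>
    and \<rho>p_hom: "is_hom r (2*r-1) (2*r-1) \<rho>p" and \<rho>p_idem: "idempotent_end (2*r-1) \<rho>p"
    and \<rho>p_im: "mimage (2*r-1) (2*r-1) \<rho>p = Xplus r"
    and \<rho>p_ker: "mkernel (2*r-1) (2*r-1) \<rho>p = {(\<lambda>w. x w + y w) | x y. x \<in> Xminus r \<and> y \<in> Y2}"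
    \<comment> \<open>\<rho>^-\<close>
    and \<rho>m_hom: "is_hom r (2*r-1) (2*r-1) \<rho>m" and \<rho>m_idem: "idempotent_end (2*r-1) \<rho>m"
    and \<rho>m_im: "mimage (2*r-1) (2*r-1) \<rho>m = Xminus r"
    and \<rho>m_ker: "mkernel (2*r-1) (2*r-1) \<rho>m = {(\<lambda>w. x w + y w) | x y. x \<in> Xplus r \<and> y \<in> Y2}"
    \<comment> \<open>\<theta>^\<plusminus> : X^\<plusminus>_{r-1} \<rightarrow> X_{r-1} module isomorphisms\<close>
    and \<theta>p_iso: "is_mod_iso r (2*r-1) (r-1) (Xplus r) (Xsimple r (r-1)) \<theta>p"
    and \<theta>m_iso: "is_mod_iso r (2*r-1) (r-1) (Xminus r) (Xsimple r (r-1)) \<theta>m"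
  shows "\<forall>m m' M. is_hom r m m' M \<longrightarrow>
           (\<exists>cs :: (complex \<times> mat) list.
              (\<forall>(a, N) \<in> set cs. (m, m', N) \<in> TLgen r (Pmat r \<theta>p \<rho>p) (Pmat r \<theta>m \<rho>m)
                                     (Imat r (Xplus r) \<theta>p \<phi>) (Imat r (Xminus r) \<theta>m \<phi>)) \<and>
              (\<forall>w\<in>twords m. \<forall>w'\<in>twords m'. M w' w = (\<Sum>(a, N) \<leftarrow> cs. a * N w' w)))"
proof (intro allI impI)
  fix m m' M assume M: "is_hom r m m' M"
  interpret odd_root r by unfold_locales (fact r_odd, fact r_ge)
  have P: "submodule_embedding r (2 * r - 1) (r - 1) (Xplus r) (Xsimple r (r - 1)) \<theta>p \<phi>"
    by unfold_locales (fact \<theta>p_iso Xplus_submodule \<phi>_hom \<phi>_idem \<phi>_im)+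
  have Q: "submodule_embedding r (2 * r - 1) (r - 1) (Xminus r) (Xsimple r (r - 1)) \<theta>m \<phi>"
    by unfold_locales (fact \<theta>m_iso Xminus_submodule \<phi>_hom \<phi>_idem \<phi>_im)+
  interpret P: submodule_embedding r "2 * r - 1" "r - 1" "Xplus r" "Xsimple r (r - 1)" \<theta>p \<phi> by (rule P)
  interpret Q: submodule_embedding r "2 * r - 1" "r - 1" "Xminus r" "Xsimple r (r - 1)" \<theta>m \<phi> by (rule Q)
  let ?Ip = "Imat r (Xplus r) \<theta>p \<phi>" and ?Im = "Imat r (Xminus r) \<theta>m \<phi>"
  have I: "?Ip = P.I" "?Im = Q.I"
    by (simp_all add: fun_eq_iff Imat_def P.I_def Q.I_def del: One_nat_def)
  obtain cp where cp: "cp \<noteq> 0" "\<forall>w. length w = 2 * r - 1 \<longrightarrow>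
      ?Ip w (replicate (r - 1) False) = (if w = replicate (2 * r - 1) False then cp else 0)"
    using Xplus_lead[OF P] by blast
  obtain cm where cm: "cm \<noteq> 0" "\<forall>v u. length v = r \<longrightarrow> length u = r - 1 \<longrightarrow>
      mcomp (r - 1) ?Im jw (replicate (r - 1) False @ v) u
        = (if v = replicate r True \<and> u = replicate (r - 1) False then cm else 0)"
    using Xminus_lead[OF Q] by blast
  interpret tl_extension r ?Ip ?Im cp cm
  proof unfold_locales
    show "is_hom r (r - 1) (2 * r - 1) ?Ip" "is_hom r (r - 1) (2 * r - 1) ?Im"
      unfolding I by (fact P.hom_I Q.hom_I)+
  qed (use cp cm in blast)+
  have "generated m m' M" using full_all M by (simp only: full_def)
  then show "\<exists>cs :: (complex \<times> mat) list.
      (\<forall>(a, N)\<in>set cs. (m, m', N) \<in> TLgen r (Pmat r \<theta>p \<rho>p) (Pmat r \<theta>m \<rho>m) ?Ip ?Im) \<and>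
      (\<forall>w\<in>twords m. \<forall>w'\<in>twords m'. M w' w = (\<Sum>(a, N)\<leftarrow>cs. a * N w' w))"
    by (rule generated_TLgen)
qed

end
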